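(* Let $p\le q\le p+1$ and $q\le\frac12-\mu$, and suppose that the noise condition $Q(y-y^\delta)\in\mathcal N_{2q}$ holds. Moreover, suppose that $(TT^\ast)^qQy\neq0$ and that $x^\dagger$ satisfies the source condition $x^\dagger=(T^\ast T)^\mu\omega$, $\|\omega\|<\infty$, with $0\le\mu\le1$. Let $\alpha_\ast$ be selected according to the modified heuristic discrepancy rule, i.e. as a minimiser of $\alpha\mapsto\psi_{\mathrm{HD}}(\alpha,y^\delta)$ over $(0,\|T\|^2)$. Then, for $\eta$ sufficiently small, $$\|x^\delta_{\alpha_\ast}-x^\dagger\|=\mathcal O\Big(\eta^{\frac{2\mu}{2\mu+2p+1}\frac{2\mu}{1-2q}}\Big).$$
   Context: Setting: $X,Y$ are Hilbert spaces and $T:X\to Y$ is a compact linear operator (possibly with nontrivial kernel) with infinite-dimensional range and adjoint $T^\ast$. $Q:Y\to\overline{\mathcal R(T)}$ is the orthogonal projection. The exact data satisfy $y\in\mathcal D(T^\dagger)$, where $T^\dagger$ is the Moore-Penrose generalised inverse, and $x^\dagger=T^\dagger y$ is the best approximate solution of $Tx=y$; if $y\notin\mathcal R(T)$, one reduces to the attainable case by considering $Tx=Qy$. Weakly bounded noise: only noisy data $y^\delta=y+e$ are available, where possibly $\|e\|=\infty$ ($e$ is then understood as a formal expansion in an orthonormal system of eigenvectors of $TT^\ast$, on which functions of $TT^\ast$ act coefficientwise), but $\eta:=\|(TT^\ast)^p(y^\delta-y)\|<\infty$ for some fixed $p\in[0,\frac12]$. $\{F_\lambda\}$ denotes the spectral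 family of $TT^\ast$. If $\{\lambda_i\}$ are the nonzero eigenvalues of $TT^\ast$ (with multiplicity) with orthonormal eigenvectors $\{u_i\}$ and $Qz=\sum_iz_iu_i$, then $\int_a^bf(\lambda)\,\mathrm d\|F_\lambda Qz\|^2=\sum_{a\le\lambda_i\le b}f(\lambda_i)|z_i|^2$. Noise condition: for $\nu\ge0$, $\mathcal N_\nu$ is the set of all $e$ for which there is a constant $C>0$ with $\alpha^{\nu+1}\int_\alpha^{\|T\|^2}\lambda^{-1}\,\mathrm d\|F_\lambda e\|^2\le C\int_0^\alpha\lambda^\nu\,\mathrm d\|F_\lambda e\|^2$ for all $\alpha\in(0,\|T\|^2)$. Tikhonov regularisation: $x^\delta_\alpha=(T^\ast T+\alpha I)^{-1}T^\ast y^\delta$ (well-defined since $p\le\frac12$). Modified heuristic discrepancy functional (with parameter $q\ge p$): $\psi_{\mathrm{HD}}(\alpha,y^\delta)=\alpha^{-q-\frac12}\|(TT^\ast)^q(Tx^\delta_\alpha-y^\delta)\|$. *)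

theory Defs
  imports "HOL-Analysis.Analysis"
begin

section \<open>Operators between Hilbert spaces\<close>

text \<open>Hilbert spaces are types of class \<open>real_inner\<close> and \<open>banach\<close>; they need not be separable.\<close>

definition compact_operator :: "('a::real_normed_vector \<Rightarrow> 'b::real_normed_vector) \<Rightarrow> bool" where
  "compact_operator T \<longleftrightarrow> linear T \<and> compact (closure (T ` cball 0 1))"

definition infinite_dimensional :: "'a::real_vector set \<Rightarrow> bool" where
  "infinite_dimensional V \<longleftrightarrow> \<not> (\<exists>F. finite F \<and> span F = V)"

definition orth_proj :: "'a::real_inner set \<Rightarrow> 'a \<Rightarrow> 'a" where
  "orth_proj V y = (THE z. z \<in> V \<and> y - z \<in> orthogonal_comp V)"

definition mp_domain :: "('a \<Rightarrow> 'b::real_inner) \<Rightarrow> 'b set" where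
  "mp_domain T = {r + s | r s. r \<in> range T \<and> s \<in> orthogonal_comp (range T)}"

definition least_squares_solution ::
    "('a \<Rightarrow> 'b::real_normed_vector) \<Rightarrow> 'b \<Rightarrow> 'a \<Rightarrow> bool" where
  "least_squares_solution T y x \<longleftrightarrow> (\<forall>z. norm (T x - y) \<le> norm (T z - y))"

text \<open>The Moore-Penrose inverse maps \<open>y\<close> to its best approximate solution, the least-squares
  solution of minimal norm. It is used on \<open>mp_domain T\<close> only.\<close>

definition mp_inverse ::
    "('a::real_normed_vector \<Rightarrow> 'b::real_normed_vector) \<Rightarrow> 'b \<Rightarrow> 'a" where
  "mp_inverse T y = (THE x. least_squares_solution T y x \<and>
     (\<forall>z. least_squares_solution T y z \<longrightarrow> norm x \<le> norm z))"


section \<open>Functional calculus in an orthonormal basis of eigenvectors\<close>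

definition eigenbasis :: "('a::real_inner \<Rightarrow> 'a) \<Rightarrow> 'a set \<Rightarrow> bool" where
  "eigenbasis S B \<longleftrightarrow> pairwise orthogonal B \<and> (\<forall>u\<in>B. norm u = 1) \<and>
     closure (span B) = UNIV \<and> (\<forall>u\<in>B. \<exists>l. S u = l *\<^sub>R u)"

definition eigval :: "('a::real_vector \<Rightarrow> 'a) \<Rightarrow> 'a \<Rightarrow> real" where
  "eigval S u = (THE l. S u = l *\<^sub>R u)"

text \<open>Powers of a nonnegative number with \<open>0\<^sup>0 = 1\<close> (whereas \<open>0 powr 0 = 0\<close>), so that the zeroth
  power of an operator is the identity, also on its kernel.\<close>

definition nn_powr :: "real \<Rightarrow> real \<Rightarrow> real" where
  "nn_powr l s = (if s = 0 then 1 else l powr s)"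

text \<open>\<open>op_powr S B s x\<close> is \<open>S\<^sup>s x\<close> for positive semidefinite \<open>S\<close> with eigenbasis \<open>B\<close>.\<close>

definition op_powr :: "('a::real_inner \<Rightarrow> 'a) \<Rightarrow> 'a set \<Rightarrow> real \<Rightarrow> 'a \<Rightarrow> 'a" where
  "op_powr S B s x = (\<Sum>\<^sub>\<infinity>u\<in>B. (nn_powr (eigval S u) s * (x \<bullet> u)) *\<^sub>R u)"

text \<open>A formal expansion \<open>\<Sum>u\<in>B. z u *\<^sub>R u\<close>, possibly of infinite norm, is represented by its
  coefficients \<open>z\<close>; a vector \<open>x\<close> of the space has the coefficients \<open>\<lambda>u. x \<bullet> u\<close>.\<close>

type_synonym 'a formal = "'a \<Rightarrow> real"

definition formal_powr :: "('a::real_vector \<Rightarrow> 'a) \<Rightarrow> real \<Rightarrow> 'a formal \<Rightarrow> 'a formal" where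
  "formal_powr S s z = (\<lambda>u. nn_powr (eigval S u) s * z u)"

definition finite_norm :: "'a set \<Rightarrow> 'a formal \<Rightarrow> bool" where
  "finite_norm B z \<longleftrightarrow> (\<lambda>u. (z u)\<^sup>2) summable_on B"

text \<open>Meaningful only if \<open>finite_norm B z\<close>.\<close>

definition formal_norm :: "'a set \<Rightarrow> 'a formal \<Rightarrow> real" where
  "formal_norm B z = sqrt (\<Sum>\<^sub>\<infinity>u\<in>B. (z u)\<^sup>2)"

text \<open>Each eigenvector of \<open>TT\<^sup>*\<close> to a nonzero eigenvalue lies in \<open>closure (range T)\<close>, and those to
  the eigenvalue zero are orthogonal to it. So the orthogonal projection onto \<open>closure (range T)\<close>
  acts on coefficients as follows.\<close>

definition formal_proj :: "('a \<Rightarrow> 'b::topological_space) \<Rightarrow> 'b formal \<Rightarrow> 'b formal" where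
  "formal_proj T z = (\<lambda>u. if u \<in> closure (range T) then z u else 0)"


section \<open>Tikhonov regularisation with weakly bounded noise\<close>

text \<open>In the following, \<open>B\<close> is an orthonormal basis of eigenvectors of \<open>TT\<^sup>*\<close>.\<close>

abbreviation TTstar ::
    "('a::real_inner \<Rightarrow> 'b::real_inner) \<Rightarrow> 'b \<Rightarrow> 'b" where
  "TTstar T \<equiv> (\<lambda>y. T (adjoint T y))"

abbreviation TstarT ::
    "('a::real_inner \<Rightarrow> 'b::real_inner) \<Rightarrow> 'a \<Rightarrow> 'a" where
  "TstarT T \<equiv> (\<lambda>x. adjoint T (T x))"

text \<open>\<open>spec_integral T B f a b z\<close> is the integral of \<open>f(\<lambda>)\<close> with respect to \<open>d\<parallel>F\<^sub>\<lambda> z\<parallel>\<^sup>2\<close> from \<open>a\<close>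
  to \<open>b\<close>, with \<open>F\<close> the spectral family of \<open>TT\<^sup>*\<close>.\<close>

definition spec_integral ::
    "('a::real_inner \<Rightarrow> 'b::real_inner) \<Rightarrow> 'b set \<Rightarrow> (real \<Rightarrow> real) \<Rightarrow> real \<Rightarrow> real \<Rightarrow> 'b formal \<Rightarrow> real"
  where
  "spec_integral T B f a b z =
     (\<Sum>\<^sub>\<infinity>u\<in>{u \<in> B. a \<le> eigval (TTstar T) u \<and> eigval (TTstar T) u \<le> b}.
        f (eigval (TTstar T) u) * (z u)\<^sup>2)"

text \<open>The noise class \<open>N\<^sub>\<nu>\<close> is the union of \<open>noise_class T B \<nu> C\<close> over all \<open>C > 0\<close>. Membership is
  meaningful if the integral on the right-hand side is finite. For \<open>\<nu> = 2q\<close> with \<open>q \<ge> p\<close> this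
  is the case whenever \<open>(TT\<^sup>*)\<^sup>p e\<close> has finite norm.\<close>

definition noise_class ::
    "('a::real_inner \<Rightarrow> 'b::real_inner) \<Rightarrow> 'b set \<Rightarrow> real \<Rightarrow> real \<Rightarrow> 'b formal set" where
  "noise_class T B \<nu> C = {e. \<forall>\<alpha>. 0 < \<alpha> \<and> \<alpha> < (onorm T)\<^sup>2 \<longrightarrow>
     \<alpha> powr (\<nu> + 1) * spec_integral T B (\<lambda>l. 1 / l) \<alpha> ((onorm T)\<^sup>2) e
       \<le> C * spec_integral T B (\<lambda>l. nn_powr l \<nu>) 0 \<alpha> e}"

text \<open>The problem \<open>T x = y\<close> with \<open>y \<in> mp_domain T\<close> is reduced to the attainable one \<open>T x = Q y\<close>, \<open>Q\<close>
  being the orthogonal projection onto \<open>closure (range T)\<close>; so the noise \<open>e\<close> is added to \<open>Q y\<close>.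
  Only the discrepancy for \<open>q = 0\<close> is affected by this, since \<open>T\<^sup>*\<close> and \<open>(TT\<^sup>*)\<^sup>q\<close> with \<open>q > 0\<close> vanish
  on \<open>y - Q y\<close>.\<close>

definition noisy_data ::
    "('a \<Rightarrow> 'b::real_inner) \<Rightarrow> 'b \<Rightarrow> 'b formal \<Rightarrow> 'b formal" where
  "noisy_data T y e = (\<lambda>u. orth_proj (closure (range T)) y \<bullet> u + e u)"

text \<open>\<open>T\<^sup>*\<close> maps formal expansions \<open>z\<close> with \<open>(TT\<^sup>*)\<^sup>p z\<close> of finite norm for some \<open>p \<le> 1/2\<close> to vectors.\<close>

definition formal_adjoint ::
    "('a::real_inner \<Rightarrow> 'b::real_inner) \<Rightarrow> 'b set \<Rightarrow> 'b formal \<Rightarrow> 'a" where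
  "formal_adjoint T B z = (\<Sum>\<^sub>\<infinity>u\<in>B. z u *\<^sub>R adjoint T u)"

definition tikhonov ::
    "('a::real_inner \<Rightarrow> 'b::real_inner) \<Rightarrow> 'b set \<Rightarrow> 'b formal \<Rightarrow> real \<Rightarrow> 'a" where
  "tikhonov T B z \<alpha> = inv (\<lambda>x. TstarT T x + \<alpha> *\<^sub>R x) (formal_adjoint T B z)"

definition psi_HD ::
    "('a::real_inner \<Rightarrow> 'b::real_inner) \<Rightarrow> 'b set \<Rightarrow> real \<Rightarrow> 'b formal \<Rightarrow> real \<Rightarrow> real" where
  "psi_HD T B q z \<alpha> = \<alpha> powr (- q - 1/2) *
     formal_norm B (formal_powr (TTstar T) q (\<lambda>u. T (tikhonov T B z \<alpha>) \<bullet> u - z u))"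

end

theory Submission
  imports Defs
begin

text \<open>In the orthonormal basis of eigenvectors of \<open>TT\<^sup>*\<close>, with eigenvalues \<open>l\<close>, the Tikhonov error is
  bounded by the data error plus \<open>\<alpha>\<^sup>\<mu>\<close> up to a constant, and the noise condition bounds the data
  error by the discrepancy functional of the projected noise. By the triangle inequality the total
  error is \<open>O(\<psi>(\<alpha>) + \<alpha>\<^sup>\<mu>)\<close>, where \<open>\<psi>\<close> is the functional of the noisy data. Comparing the minimiser
  with \<open>\<alpha> = \<eta> powr (2 / (2\<mu> + 2p + 1))\<close> gives \<open>\<psi>(\<alpha>\<^sub>*) = O(\<eta> powr (2\<mu> / (2\<mu> + 2p + 1)))\<close>. Conversely a
  single coefficient on which \<open>(TT\<^sup>*)\<^sup>q Q y\<close> does not vanish yields \<open>\<psi>(\<alpha>) \<ge> c * \<alpha> powr (1/2 - q)\<close> for small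
  \<open>\<eta>\<close>, hence an upper bound on \<open>\<alpha>\<^sub>*\<close> in terms of \<open>\<psi>(\<alpha>\<^sub>*)\<close>.\<close>

section \<open>Orthogonal series in Hilbert spaces\<close>

text \<open>By Pythagoras, the squared distance between nested partial sums is a difference of
  partial sums of squared norms. The net of partial sums is therefore Cauchy, and completeness
  supplies the limit.\<close>

lemma orthogonal_series_summable:
  fixes g :: "'i \<Rightarrow> 'a::{real_inner,banach}"
  assumes orth: "pairwise (\<lambda>i j. orthogonal (g i) (g j)) I"
    and sq: "(\<lambda>i. (norm (g i))\<^sup>2) summable_on I"
  shows "g summable_on I"
proof -
  let ?s = "\<lambda>F. \<Sum>i\<in>F. (norm (g i))\<^sup>2"
  obtain L where lim: "(?s \<longlongrightarrow> L) (finite_subsets_at_top I)"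
    using sq unfolding summable_on_def has_sum_def by blast
  have "\<exists>P. eventually P (finite_subsets_at_top I) \<and>
              (\<forall>F F'. P F \<and> P F' \<longrightarrow> dist (sum g F) (sum g F') < e)" if "e > 0" for e
  proof -
    \<comment> \<open>Two partial sums of squares within \<open>d\<close> of \<open>L\<close> differ
      by less than \<open>2 * d\<close>, the square of \<open>e/2\<close>. Thus all later sums lie
      within \<open>e/2\<close> of \<open>sum g F0\<close>.\<close>
    define d where "d = (e/2)\<^sup>2 / 2"
    have "d > 0" using that by (simp add: d_def)
    have "\<forall>\<^sub>F F in finite_subsets_at_top I. dist (?s F) L < d"
      using lim \<open>d > 0\<close> by (auto simp: tendsto_iff)
    then obtain F0 where F0: "finite F0" "F0 \<subseteq> I"
      and close: "\<And>F. finite F \<Longrightarrow> F0 \<subseteq> F \<Longrightarrow> F \<subseteq> I \<Longrightarrow> dist (?s F) L < d"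
      unfolding eventually_finite_subsets_at_top by metis
    have near: "dist (sum g F) (sum g F0) < e/2" if F: "finite F" "F0 \<subseteq> F" "F \<subseteq> I" for F
    proof -
      have "(norm (sum g F - sum g F0))\<^sup>2 = (norm (sum g (F - F0)))\<^sup>2"
        using F by (simp add: sum_diff)
      also have "\<dots> = ?s (F - F0)"
        using F by (intro norm_sum_Pythagorean pairwise_subset[OF orth]) auto
      also have "\<dots> = ?s F - ?s F0"
        using F by (simp add: sum_diff)
      also have "\<dots> < (e/2)\<^sup>2"
        using close[OF F] close[OF F0(1) order.refl F0(2)] unfolding dist_real_def d_def by linarith
      finally have "norm (sum g F - sum g F0) < e/2"
        by (rule power2_less_imp_less) (use \<open>e > 0\<close> in simp)
      then show ?thesis
        by (simp add: dist_norm)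
    qed
    show ?thesis
    proof (intro exI[of _ "\<lambda>F. finite F \<and> F0 \<subseteq> F \<and> F \<subseteq> I"] conjI allI impI)
      show "\<forall>\<^sub>F F in finite_subsets_at_top I. finite F \<and> F0 \<subseteq> F \<and> F \<subseteq> I"
        unfolding eventually_finite_subsets_at_top using F0 by blast
      fix F F' assume "(finite F \<and> F0 \<subseteq> F \<and> F \<subseteq> I) \<and> (finite F' \<and> F0 \<subseteq> F' \<and> F' \<subseteq> I)"
      then show "dist (sum g F) (sum g F') < e"
        using near[of F] near[of F'] dist_triangle_half_r[of "sum g F0" "sum g F" e "sum g F'"]
        by (simp add: dist_commute)
    qed
  qed
  then have "cauchy_filter (filtermap (sum g) (finite_subsets_at_top I))"
    by (simp add: cauchy_filter_metric_filtermap)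
  moreover have "complete (UNIV::'a set)"
    by (meson Cauchy_convergent UNIV_I complete_def convergent_def)
  ultimately obtain L' where "(sum g \<longlongrightarrow> L') (finite_subsets_at_top I)"
    using complete_uniform[where S=UNIV] by (force simp add: filterlim_def)
  then show ?thesis
    using summable_on_def has_sum_def by blast
qed

lemma has_sum_inner_left:
  assumes "(g has_sum x) I"
  shows "((\<lambda>i. a \<bullet> g i) has_sum (a \<bullet> x)) I"
  using has_sum_bounded_linear[OF bounded_linear_inner_right assms] .

text \<open>The inner product is continuous, so it may be taken term by term, and a single term
  survives. This reads coefficients off orthogonal expansions.\<close>

lemma orthogonal_series_inner:
  assumes "(g has_sum x) I" "j \<in> I" "\<And>i. i \<in> I \<Longrightarrow> i \<noteq> j \<Longrightarrow> a \<bullet> g i = 0"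
  shows "a \<bullet> x = a \<bullet> g j"
proof -
  have "((\<lambda>i. a \<bullet> g i) has_sum (a \<bullet> g j)) I"
    using assms(2,3) by (intro has_sum_finite_neutralI[of "{j}"]) auto
  then show ?thesis
    using has_sum_inner_left[OF assms(1), of a] has_sum_unique by blast
qed

lemma orthogonal_series_norm:
  fixes g :: "'i \<Rightarrow> 'a::real_inner"
  assumes orth: "pairwise (\<lambda>i j. orthogonal (g i) (g j)) I"
    and "(g has_sum x) I"
  shows "((\<lambda>i. (norm (g i))\<^sup>2) has_sum (norm x)\<^sup>2) I"
proof -
  have "x \<bullet> g j = (norm (g j))\<^sup>2" if "j \<in> I" for j
  proof -
    have "g j \<bullet> x = g j \<bullet> g j"
      using that orth
      by (intro orthogonal_series_inner[OF assms(2)]) (auto simp: pairwise_def orthogonal_def)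
    then show ?thesis
      by (simp add: power2_norm_eq_inner inner_commute)
  qed
  then have "((\<lambda>i. (norm (g i))\<^sup>2) has_sum (x \<bullet> x)) I"
    using has_sum_inner_left[OF assms(2), of x] has_sum_cong[of I "\<lambda>i. x \<bullet> g i"] by simp
  then show ?thesis
    by (simp add: power2_norm_eq_inner)
qed

lemma bessel_summable:
  fixes v :: "'i \<Rightarrow> 'a::real_inner"
  assumes orth: "pairwise (\<lambda>i j. orthogonal (v i) (v j)) I"
    and unit: "\<And>i. i \<in> I \<Longrightarrow> norm (v i) \<le> 1"
  shows "(\<lambda>i. (x \<bullet> v i)\<^sup>2) summable_on I"
proof -
  have fin: "(\<Sum>i\<in>F. (x \<bullet> v i)\<^sup>2) \<le> (norm x)\<^sup>2" if F: "finite F" "F \<subseteq> I" for F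
  proof -
    let ?g = "\<lambda>i. (x \<bullet> v i) *\<^sub>R v i" and ?S = "\<Sum>i\<in>F. (x \<bullet> v i)\<^sup>2"
    have "(norm (sum ?g F))\<^sup>2 = (\<Sum>i\<in>F. (norm (?g i))\<^sup>2)"
      using F pairwise_subset[OF orth]
      by (intro norm_sum_Pythagorean) (auto simp: pairwise_def orthogonal_def)
    also have "\<dots> \<le> ?S"
    proof (rule sum_mono)
      fix i assume "i \<in> F"
      then have "(norm (v i))\<^sup>2 \<le> 1"
        using unit F by (simp add: power_le_one subset_iff)
      then show "(norm (?g i))\<^sup>2 \<le> (x \<bullet> v i)\<^sup>2"
        using mult_left_mono[of "(norm (v i))\<^sup>2" 1 "(x \<bullet> v i)\<^sup>2"] by (simp add: power_mult_distrib)
    qed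
    finally have 1: "(norm (sum ?g F))\<^sup>2 \<le> ?S" .
    have "x \<bullet> sum ?g F = ?S"
      by (simp add: inner_sum_right power2_eq_square)
    \<comment> \<open>Expanding this square gives \<open>0\<close> \<le>
      \<open>(norm x)^2 - 2 * ?S\<close> plus the squared norm of the projection, and the latter is
      at most \<open>?S\<close>.\<close>
    moreover have "0 \<le> (x - sum ?g F) \<bullet> (x - sum ?g F)"
      by simp
    ultimately show ?thesis
      using 1 by (simp add: inner_diff_left inner_diff_right inner_commute power2_norm_eq_inner)
  qed
  then show ?thesis
    by (intro nonneg_bdd_above_summable_on) (auto intro!: bdd_aboveI2)
qed

section \<open>Complete orthonormal sets and the existence of the adjoint\<close>

lemma dense_span_bounded_linear_eq:
  fixes f g :: "'a::real_normed_vector \<Rightarrow> real"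
  assumes "closure (span D) = UNIV" "bounded_linear f" "bounded_linear g"
    and "\<And>d. d \<in> D \<Longrightarrow> f d = g d"
  shows "f x = g x"
proof -
  have "linear f" "linear g"
    using assms by (simp_all add: bounded_linear.linear)
  then have "f z = g z" if "z \<in> span D" for z
    using that assms(4) linear_eq_on_span by blast
  moreover have "closed {z. f z = g z}"
    using assms by (intro closed_Collect_eq) (auto simp: linear_continuous_on)
  ultimately have "closure (span D) \<subseteq> {z. f z = g z}"
    by (intro closure_minimal) auto
  then show ?thesis
    using assms(1) by auto
qed

lemma orthogonal_to_dense_eq_0:
  fixes x :: "'a::real_inner"
  assumes "closure (span D) = UNIV" "\<And>d. d \<in> D \<Longrightarrow> x \<bullet> d = 0"
  shows "x = 0"
proof -
  have "x \<bullet> x = (0::real)"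
    by (rule dense_span_bounded_linear_eq[OF assms(1), where f = "\<lambda>z. x \<bullet> z" and g = "\<lambda>_. 0"])
      (simp_all add: assms(2) bounded_linear_inner_right)
  then show ?thesis by simp
qed

lemma orthonormal_scaled_summable:
  fixes D :: "'a::{real_inner,banach} set"
  assumes "pairwise orthogonal D" "\<And>d. d \<in> D \<Longrightarrow> norm d = 1" "(\<lambda>d. (c d)\<^sup>2) summable_on D"
  shows "(\<lambda>d. c d *\<^sub>R d) summable_on D"
proof (rule orthogonal_series_summable)
  show "pairwise (\<lambda>i j. orthogonal (c i *\<^sub>R i) (c j *\<^sub>R j)) D"
    using assms(1) by (auto simp: pairwise_def orthogonal_def)
  have "(norm (c d *\<^sub>R d))\<^sup>2 = (c d)\<^sup>2" if "d \<in> D" for d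
    using assms(2) that by simp
  then show "(\<lambda>d. (norm (c d *\<^sub>R d))\<^sup>2) summable_on D"
    using assms(3) by (simp cong: summable_on_cong)
qed

lemma orthonormal_series_coeff:
  assumes "pairwise orthogonal D" "\<And>d. d \<in> D \<Longrightarrow> norm d = 1"
    "((\<lambda>d. c d *\<^sub>R d) has_sum x) D" "d \<in> D"
  shows "x \<bullet> d = c d"
proof -
  have "d \<bullet> x = d \<bullet> (c d *\<^sub>R d)"
    using assms(1,4)
    by (intro orthogonal_series_inner[OF assms(3)]) (auto simp: pairwise_def orthogonal_def)
  then show ?thesis
    using assms(2,4) by (simp add: inner_commute norm_eq_1)
qed

text \<open>Bessel makes the series converge to some \<open>w\<close> with the same coefficients as
  \<open>x\<close>; the difference is orthogonal to a dense span.\<close>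

lemma orthonormal_expansion:
  fixes D :: "'a::{real_inner,banach} set"
  assumes "pairwise orthogonal D" "\<And>d. d \<in> D \<Longrightarrow> norm d = 1" "closure (span D) = UNIV"
  shows "((\<lambda>d. (x \<bullet> d) *\<^sub>R d) has_sum x) D"
proof -
  have "(\<lambda>d. (x \<bullet> d)\<^sup>2) summable_on D"
    using assms by (intro bessel_summable) auto
  then obtain w where w: "((\<lambda>d. (x \<bullet> d) *\<^sub>R d) has_sum w) D"
    using orthonormal_scaled_summable[of D "\<lambda>d. x \<bullet> d"] assms(1,2) by (auto simp: summable_on_def)
  have "x - w = 0"
    using orthonormal_series_coeff[OF assms(1,2) w]
    by (intro orthogonal_to_dense_eq_0[OF assms(3)]) (simp add: inner_diff_left)
  then show ?thesis using w by simp
qed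

text \<open>\<open>adjoint\<close> is a choice operator, so its identity requires a witness. The
  Riesz representer of \<open>x\<close> \<mapsto> \<open>T x\<close> \<bullet> \<open>y\<close> is
  built as the series with coefficients \<open>T d\<close> \<bullet> \<open>y\<close>.\<close>

lemma adjoint_exists_orthonormal_basis:
  fixes T :: "'a::{real_inner,banach} \<Rightarrow> 'b::real_inner" and D :: "'a set"
  assumes T: "bounded_linear T"
    and D: "pairwise orthogonal D" "\<And>d. d \<in> D \<Longrightarrow> norm d = 1" "closure (span D) = UNIV"
  shows "T x \<bullet> y = x \<bullet> adjoint T y"
proof -
  have "\<exists>z. \<forall>x. T x \<bullet> y = x \<bullet> z" for y
  proof -
    let ?c = "\<lambda>d. T d \<bullet> y"
    have "(\<Sum>d\<in>F. (?c d)\<^sup>2) \<le> (onorm T * norm y)\<^sup>2" if F: "finite F" "F \<subseteq> D" for F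
    proof -
      let ?S = "\<Sum>d\<in>F. (?c d)\<^sup>2" and ?w = "\<Sum>d\<in>F. ?c d *\<^sub>R d"
      have "pairwise orthogonal F"
        using D(1) F(2) pairwise_subset by blast
      then have "(norm ?w)\<^sup>2 = (\<Sum>d\<in>F. (norm (?c d *\<^sub>R d))\<^sup>2)"
        using F(1) by (intro norm_sum_Pythagorean) (auto simp: pairwise_def orthogonal_def)
      also have "\<dots> = ?S"
        using D(2) F by (intro sum.cong) auto
      finally have w: "(norm ?w)\<^sup>2 = ?S" .
      \<comment> \<open>Testing \<open>y\<close> against the image of the partial series bounds
        \<open>(norm ?w)^2\<close> by a multiple of \<open>norm ?w\<close>. Cancelling one factor
        leaves a bound independent of \<open>F\<close>.\<close>
      have "?S = T ?w \<bullet> y"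
        using T by (simp add: bounded_linear.linear linear_sum linear_scale inner_sum_left power2_eq_square)
      also have "\<dots> \<le> norm (T ?w) * norm y"
        by (rule norm_cauchy_schwarz)
      also have "\<dots> \<le> (onorm T * norm ?w) * norm y"
        using onorm[OF T] by (intro mult_right_mono) auto
      finally have le: "norm ?w * norm ?w \<le> (onorm T * norm y) * norm ?w"
        using w by (simp add: power2_eq_square mult_ac)
      have "norm ?w \<le> onorm T * norm y"
      proof (cases "norm ?w = 0")
        case True
        then show ?thesis using onorm_pos_le[OF T] by simp
      next
        case False
        then show ?thesis using le by (simp add: mult_le_cancel_right)
      qed
      from power_mono[OF this norm_ge_zero, of 2] show ?thesis
        unfolding w .
    qed
    then have "bdd_above (sum (\<lambda>d. (?c d)\<^sup>2) ` {F. F \<subseteq> D \<and> finite F})"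
      by (intro bdd_aboveI2[where M = "(onorm T * norm y)\<^sup>2"]) blast
    then have "(\<lambda>d. (?c d)\<^sup>2) summable_on D"
      by (intro nonneg_bdd_above_summable_on) simp_all
    then obtain z where z: "((\<lambda>d. ?c d *\<^sub>R d) has_sum z) D"
      using orthonormal_scaled_summable[of D ?c] D by (auto simp: summable_on_def)
    have "T x \<bullet> y = x \<bullet> z" for x
    proof (rule dense_span_bounded_linear_eq[OF D(3), where f = "\<lambda>x. T x \<bullet> y" and g = "\<lambda>x. x \<bullet> z"])
      show "bounded_linear (\<lambda>x. T x \<bullet> y)"
        using bounded_linear_compose[OF bounded_linear_inner_left T] .
      show "bounded_linear (\<lambda>x. x \<bullet> z)"
        by (rule bounded_linear_inner_left)
      fix d assume "d \<in> D"
      then show "T d \<bullet> y = d \<bullet> z"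
        using orthonormal_series_coeff[OF D(1,2) z] by (simp add: inner_commute)
    qed
    then show ?thesis by blast
  qed
  then obtain f' where "\<forall>x y. T x \<bullet> y = x \<bullet> f' y"
    by metis
  then have "\<forall>x y. T x \<bullet> y = x \<bullet> adjoint T y"
    unfolding adjoint_def by (rule someI[where P = "\<lambda>f'. \<forall>x y. T x \<bullet> y = x \<bullet> f' y"])
  then show ?thesis by blast
qed

lemma compact_operator_bounded_linear:
  assumes "compact_operator T"
  shows "bounded_linear T"
proof -
  have lin: "linear T" and "bounded (T ` cball 0 1)"
    using assms compact_imp_bounded bounded_subset closure_subset
    unfolding compact_operator_def by blast+
  then obtain M where "\<forall>x\<in>cball 0 1. norm (T x) \<le> M"
    by (auto simp: bounded_iff)
  then have M: "norm (T x) \<le> M" if "norm x \<le> 1" for x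
    using that by simp
  have "norm (T x) \<le> norm x * M" for x
  proof (cases "x = 0")
    case True
    then show ?thesis using lin linear_0 by auto
  next
    case False
    have "norm (T (x /\<^sub>R norm x)) \<le> M"
      using False by (intro M) simp
    then show ?thesis
      using False lin by (simp add: linear_scale field_simps)
  qed
  then show ?thesis
    using lin by (auto simp: bounded_linear_def bounded_linear_axioms_def)
qed

section \<open>Weighted square-summable coefficients\<close>

lemma formal_norm_nonneg [simp]: "0 \<le> formal_norm B z"
  unfolding formal_norm_def by (intro real_sqrt_ge_zero infsum_nonneg) simp

lemma formal_norm_square: "(formal_norm B z)\<^sup>2 = (\<Sum>\<^sub>\<infinity>u\<in>B. (z u)\<^sup>2)"
  unfolding formal_norm_def by (intro real_sqrt_pow2 infsum_nonneg) simp

lemma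
  assumes "finite_norm B g" "0 \<le> c" "\<And>u. u \<in> B \<Longrightarrow> \<bar>f u\<bar> \<le> c * \<bar>g u\<bar>"
  shows finite_norm_bound: "finite_norm B f"
    and formal_norm_bound: "formal_norm B f \<le> c * formal_norm B g"
proof -
  have le: "(f u)\<^sup>2 \<le> c\<^sup>2 * (g u)\<^sup>2" if "u \<in> B" for u
    using power_mono[OF assms(3)[OF that] abs_ge_zero, of 2] by (simp add: power_mult_distrib)
  have sg: "(\<lambda>u. c\<^sup>2 * (g u)\<^sup>2) summable_on B"
    using assms(1) by (simp add: finite_norm_def summable_on_cmult_right)
  then have sf: "(\<lambda>u. (f u)\<^sup>2) summable_on B"
    by (rule summable_on_comparison_test) (use le in auto)
  then show "finite_norm B f"
    by (simp add: finite_norm_def)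
  have "(formal_norm B f)\<^sup>2 \<le> (\<Sum>\<^sub>\<infinity>u\<in>B. c\<^sup>2 * (g u)\<^sup>2)"
    unfolding formal_norm_square by (rule infsum_mono[OF sf sg le])
  also have "\<dots> = (c * formal_norm B g)\<^sup>2"
    using assms(1) by (simp add: power_mult_distrib formal_norm_square infsum_cmult_right finite_norm_def)
  finally show "formal_norm B f \<le> c * formal_norm B g"
    by (rule power2_le_imp_le) (simp add: assms(2))
qed

lemma formal_norm_mono:
  assumes "finite_norm B g" "\<And>u. u \<in> B \<Longrightarrow> \<bar>f u\<bar> \<le> \<bar>g u\<bar>"
  shows "formal_norm B f \<le> formal_norm B g"
  using formal_norm_bound[of B g 1 f] assms by simp

lemma formal_norm_coord:
  assumes "finite_norm B z" "u \<in> B"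
  shows "\<bar>z u\<bar> \<le> formal_norm B z"
proof -
  have "(\<Sum>u\<in>{u}. (z u)\<^sup>2) \<le> (\<Sum>\<^sub>\<infinity>u\<in>B. (z u)\<^sup>2)"
    using assms by (intro finite_sum_le_infsum) (auto simp: finite_norm_def)
  then have "\<bar>z u\<bar>\<^sup>2 \<le> (formal_norm B z)\<^sup>2"
    by (simp add: formal_norm_square)
  then show ?thesis
    by (rule power2_le_imp_le) simp
qed

text \<open>Minkowski's inequality on finite index sets, carried over to the infinite sum since the
  bound does not depend on the finite set.\<close>

lemma
  assumes f: "finite_norm B f" and g: "finite_norm B g"
  shows finite_norm_add: "finite_norm B (\<lambda>u. f u + g u)"
    and formal_norm_triangle: "formal_norm B (\<lambda>u. f u + g u) \<le> formal_norm B f + formal_norm B g"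
proof -
  let ?b = "formal_norm B f + formal_norm B g"
  have part: "L2_set h F \<le> formal_norm B h" if "finite_norm B h" "finite F" "F \<subseteq> B" for h F
    unfolding L2_set_def formal_norm_def
    by (intro real_sqrt_le_mono finite_sum_le_infsum) (use that in \<open>auto simp: finite_norm_def\<close>)
  have fin: "(\<Sum>u\<in>F. (f u + g u)\<^sup>2) \<le> ?b\<^sup>2" if "finite F" "F \<subseteq> B" for F
  proof -
    have "L2_set (\<lambda>u. f u + g u) F \<le> ?b"
      using L2_set_triangle_ineq[of f g F] part[OF f that] part[OF g that] by linarith
    then show ?thesis
      unfolding L2_set_def by (rule sqrt_le_D)
  qed
  then have "bdd_above (sum (\<lambda>u. (f u + g u)\<^sup>2) ` {F. F \<subseteq> B \<and> finite F})"
    by (intro bdd_aboveI2[where M = "?b\<^sup>2"]) blast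
  then have sm: "(\<lambda>u. (f u + g u)\<^sup>2) summable_on B"
    by (intro nonneg_bdd_above_summable_on) simp_all
  then show "finite_norm B (\<lambda>u. f u + g u)"
    by (simp add: finite_norm_def)
  have "(formal_norm B (\<lambda>u. f u + g u))\<^sup>2 \<le> ?b\<^sup>2"
    unfolding formal_norm_square by (rule infsum_le_finite_sums[OF sm fin])
  then show "formal_norm B (\<lambda>u. f u + g u) \<le> ?b"
    by (rule power2_le_imp_le) simp
qed

section \<open>Nonnegative powers and the Tikhonov filter\<close>

lemma nn_powr_nonneg [simp]: "0 \<le> nn_powr l s"
  by (simp add: nn_powr_def)

lemma nn_powr_pos: "0 < l \<Longrightarrow> nn_powr l s = l powr s"
  by (simp add: nn_powr_def)

lemma nn_powr_add: "0 \<le> s \<Longrightarrow> 0 \<le> t \<Longrightarrow> nn_powr l (s + t) = nn_powr l s * nn_powr l t"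
  by (auto simp: nn_powr_def powr_add)

lemma nn_powr_mono: "0 \<le> l \<Longrightarrow> l \<le> m \<Longrightarrow> 0 \<le> s \<Longrightarrow> nn_powr l s \<le> nn_powr m s"
  by (simp add: nn_powr_def powr_mono2)

lemma nn_powr_square: "0 \<le> s \<Longrightarrow> (nn_powr l s)\<^sup>2 = nn_powr l (2 * s)"
  using nn_powr_add[of s s l] by (simp add: power2_eq_square)

text \<open>For \<open>s\<close> in the unit interval both exponents \<open>s\<close> and
  \<open>1 - s\<close> are nonnegative, so the product of the powers of \<open>l\<close> and
  \<open>a\<close> is at most \<open>l + a\<close>. The range of \<open>s\<close> is the
  qualification of the residual filter.\<close>

lemma nn_powr_filter_bound:
  assumes "0 \<le> l" "0 < a" "0 \<le> s" "s \<le> 1"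
  shows "nn_powr l s * (a / (l + a)) \<le> a powr s"
proof -
  have "nn_powr l s * a powr (1 - s) \<le> nn_powr (l + a) s * (l + a) powr (1 - s)"
    using assms by (intro mult_mono nn_powr_mono powr_mono2) auto
  also have "\<dots> = l + a"
    using assms by (simp add: nn_powr_pos flip: powr_add)
  finally have "nn_powr l s * a powr (1 - s) * a powr s \<le> (l + a) * a powr s"
    by (intro mult_right_mono) auto
  moreover have "a powr (1 - s) * a powr s = a"
    using assms by (simp flip: powr_add)
  ultimately show ?thesis
    using assms by (simp add: field_simps)
qed

section \<open>The heuristic discrepancy functional on coefficients\<close>

text \<open>The factor \<open>a / (l + a)\<close> is \<open>1 - l / (l + a)\<close>, the residual
  filter of Tikhonov regularisation. With \<open>q = 0\<close>, applied to the coefficients of the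
  solution, the same expression describes the approximation error.\<close>

definition residual_coeff :: "('i \<Rightarrow> real) \<Rightarrow> real \<Rightarrow> ('i \<Rightarrow> real) \<Rightarrow> real \<Rightarrow> 'i \<Rightarrow> real" where
  "residual_coeff l q z a = (\<lambda>u. nn_powr (l u) q * (a / (l u + a)) * z u)"

definition hd_coeff :: "'i set \<Rightarrow> ('i \<Rightarrow> real) \<Rightarrow> real \<Rightarrow> ('i \<Rightarrow> real) \<Rightarrow> real \<Rightarrow> real" where
  "hd_coeff B l q z a = a powr (- q - 1/2) * formal_norm B (residual_coeff l q z a)"

text \<open>One estimate serves three purposes: exact data with \<open>r = q + 1/2 +\<close>\<mu>,
  noise with \<open>r = q - p\<close>, and the approximation error with \<open>q = 0\<close>,
  \<open>r =\<close>\<mu>. In the first two cases \<open>r\<close> \<le> \<open>1\<close> is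
  precisely \<open>q\<close> \<le> \<open>1/2 -\<close>\<mu> and \<open>q\<close> \<le>
  \<open>p + 1\<close>.\<close>

lemma
  assumes l: "\<And>u. u \<in> B \<Longrightarrow> 0 \<le> l u" and a: "0 < a" and r: "0 \<le> r" "r \<le> 1"
    and w: "finite_norm B w"
    and z: "\<And>u. u \<in> B \<Longrightarrow> nn_powr (l u) q * \<bar>z u\<bar> \<le> nn_powr (l u) r * \<bar>w u\<bar>"
  shows finite_residual_bound: "finite_norm B (residual_coeff l q z a)"
    and formal_norm_residual_bound: "formal_norm B (residual_coeff l q z a) \<le> a powr r * formal_norm B w"
    and hd_coeff_bound: "hd_coeff B l q z a \<le> a powr (r - q - 1/2) * formal_norm B w"
proof -
  have le: "\<bar>residual_coeff l q z a u\<bar> \<le> a powr r * \<bar>w u\<bar>" if u: "u \<in> B" for u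
  proof -
    have "\<bar>residual_coeff l q z a u\<bar> = (a / (l u + a)) * (nn_powr (l u) q * \<bar>z u\<bar>)"
      using l[OF u] a by (simp add: residual_coeff_def abs_mult)
    also have "\<dots> \<le> (a / (l u + a)) * (nn_powr (l u) r * \<bar>w u\<bar>)"
      using l[OF u] a by (intro mult_left_mono z u) simp
    also have "\<dots> = (nn_powr (l u) r * (a / (l u + a))) * \<bar>w u\<bar>"
      by simp
    also have "\<dots> \<le> a powr r * \<bar>w u\<bar>"
      by (intro mult_right_mono nn_powr_filter_bound l u a r) simp
    finally show ?thesis .
  qed
  show "finite_norm B (residual_coeff l q z a)"
    by (rule finite_norm_bound[OF w _ le]) simp
  show "formal_norm B (residual_coeff l q z a) \<le> a powr r * formal_norm B w"
    by (rule formal_norm_bound[OF w _ le]) simp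
  then have "hd_coeff B l q z a \<le> a powr (- q - 1/2) * (a powr r * formal_norm B w)"
    unfolding hd_coeff_def by (rule mult_left_mono) simp
  also have "\<dots> = a powr (r - q - 1/2) * formal_norm B w"
    using powr_add[of a "- q - 1/2" r] by (simp add: algebra_simps)
  finally show "hd_coeff B l q z a \<le> a powr (r - q - 1/2) * formal_norm B w" .
qed

lemma
  assumes x: "finite_norm B (residual_coeff l q x a)" and z: "finite_norm B (residual_coeff l q z a)"
  shows finite_residual_add: "finite_norm B (residual_coeff l q (\<lambda>u. x u + z u) a)"
    and hd_coeff_triangle: "hd_coeff B l q (\<lambda>u. x u + z u) a \<le> hd_coeff B l q x a + hd_coeff B l q z a"
proof -
  have eq: "residual_coeff l q (\<lambda>u. x u + z u) a
      = (\<lambda>u. residual_coeff l q x a u + residual_coeff l q z a u)"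
    by (simp add: residual_coeff_def distrib_left)
  show "finite_norm B (residual_coeff l q (\<lambda>u. x u + z u) a)"
    unfolding eq using x z by (rule finite_norm_add)
  show "hd_coeff B l q (\<lambda>u. x u + z u) a \<le> hd_coeff B l q x a + hd_coeff B l q z a"
    unfolding hd_coeff_def eq distrib_left[symmetric]
    using formal_norm_triangle[OF x z] by (rule mult_left_mono) simp
qed

lemma hd_coeff_mono:
  assumes "finite_norm B (residual_coeff l q z a)" "\<And>u. u \<in> B \<Longrightarrow> \<bar>x u\<bar> \<le> \<bar>z u\<bar>"
  shows "hd_coeff B l q x a \<le> hd_coeff B l q z a"
  unfolding hd_coeff_def
  by (intro mult_left_mono formal_norm_mono assms(1))
    (use assms(2) in \<open>auto simp: residual_coeff_def abs_mult intro!: divide_right_mono mult_left_mono\<close>)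

text \<open>A single coordinate bounds the norm from below, and \<open>l u + a\<close> \<le>
  \<open>2 * L\<close> keeps the filter above \<open>a / (2 * L)\<close>.\<close>

lemma hd_coeff_lower_bound:
  assumes "finite_norm B (residual_coeff l q z a)" "u \<in> B" "0 \<le> l u" "l u \<le> L" "0 < a" "a \<le> L"
  shows "nn_powr (l u) q * \<bar>z u\<bar> / (2 * L) * a powr (1/2 - q) \<le> hd_coeff B l q z a"
proof -
  have "1 / (2 * L) \<le> 1 / (l u + a)"
    using assms by (intro divide_left_mono) auto
  then have "a / (2 * L) \<le> a / (l u + a)"
    using mult_left_mono[of "1 / (2 * L)" "1 / (l u + a)" a] assms(5) by simp
  then have "(nn_powr (l u) q * \<bar>z u\<bar>) * (a / (2 * L)) \<le> (nn_powr (l u) q * \<bar>z u\<bar>) * (a / (l u + a))"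
    by (rule mult_left_mono) simp
  also have "\<dots> = \<bar>residual_coeff l q z a u\<bar>"
    using assms by (simp add: residual_coeff_def abs_mult)
  also have "\<dots> \<le> formal_norm B (residual_coeff l q z a)"
    using assms by (intro formal_norm_coord)
  finally have "a powr (- q - 1/2) * (nn_powr (l u) q * \<bar>z u\<bar> * (a / (2 * L))) \<le> hd_coeff B l q z a"
    unfolding hd_coeff_def by (rule mult_left_mono) simp
  moreover have eq: "a powr (1/2 - q) = a powr (- q - 1/2) * a"
    using powr_add[of a "- q - 1/2" 1] assms(5) by simp
  ultimately show ?thesis
    unfolding eq by (simp add: mult_ac)
qed

text \<open>The noise condition trades the high frequencies of the data error for the low ones, and on
  the low frequencies the residual filter \<open>a / (l + a)\<close> is at least \<open>1/2\<close>.\<close>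

lemma
  assumes l: "\<And>u. u \<in> B \<Longrightarrow> 0 \<le> l u \<and> l u \<le> L" and a: "0 < a"
    and pq: "0 \<le> p" "p \<le> q" "q \<le> 1/2" "q \<le> p + 1" and C: "0 < C"
    and e: "finite_norm B (\<lambda>u. nn_powr (l u) p * e u)"
    and noise: "a powr (2 * q + 1) * (\<Sum>\<^sub>\<infinity>u\<in>{u\<in>B. a \<le> l u \<and> l u \<le> L}. 1 / l u * (e u)\<^sup>2)
      \<le> C * (\<Sum>\<^sub>\<infinity>u\<in>{u\<in>B. 0 \<le> l u \<and> l u \<le> a}. nn_powr (l u) (2 * q) * (e u)\<^sup>2)"
  shows finite_data_error: "finite_norm B (\<lambda>u. sqrt (l u) / (l u + a) * e u)"
    and data_error_le_hd_coeff:
      "formal_norm B (\<lambda>u. sqrt (l u) / (l u + a) * e u) \<le> 2 * sqrt (C + 1) * hd_coeff B l q e a"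
proof -
  let ?f = "\<lambda>u. (sqrt (l u) / (l u + a) * e u)\<^sup>2"
  let ?G = "\<lambda>u. (residual_coeff l q e a u)\<^sup>2"
  let ?n = "\<lambda>u. nn_powr (l u) (2 * q) * (e u)\<^sup>2"
  let ?B1 = "{u\<in>B. a \<le> l u \<and> l u \<le> L}" and ?B2 = "{u\<in>B. l u < a}"
  let ?B3 = "{u\<in>B. 0 \<le> l u \<and> l u \<le> a}"
  show fin: "finite_norm B (\<lambda>u. sqrt (l u) / (l u + a) * e u)"
  proof (rule finite_norm_bound[OF e, of "a powr (1/2 - p) / a"])
    show "0 \<le> a powr (1/2 - p) / a" using a by simp
    fix u assume u: "u \<in> B"
    \<comment> \<open>Split off the power \<open>p\<close> for which the noise is square summable;
      the remaining power \<open>1/2 - p\<close> is absorbed by the filter bound.\<close>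
    have "sqrt (l u) = nn_powr (l u) (1/2 - p + p)"
      using l[OF u] by (simp add: nn_powr_def powr_half_sqrt)
    also have "\<dots> = nn_powr (l u) (1/2 - p) * nn_powr (l u) p"
      using pq by (intro nn_powr_add) auto
    finally have "sqrt (l u) / (l u + a)
        = (nn_powr (l u) (1/2 - p) * (a / (l u + a))) / a * nn_powr (l u) p"
      using a by simp
    also have "\<dots> \<le> a powr (1/2 - p) / a * nn_powr (l u) p"
      using l[OF u] a pq by (intro mult_right_mono divide_right_mono nn_powr_filter_bound) auto
    finally have "sqrt (l u) / (l u + a) * \<bar>e u\<bar> \<le> a powr (1/2 - p) / a * nn_powr (l u) p * \<bar>e u\<bar>"
      by (rule mult_right_mono) simp
    then show "\<bar>sqrt (l u) / (l u + a) * e u\<bar> \<le> a powr (1/2 - p) / a * \<bar>nn_powr (l u) p * e u\<bar>"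
      using l[OF u] a by (simp add: abs_mult mult.assoc)
  qed
  have "finite_norm B (residual_coeff l q e a)"
  proof (rule finite_residual_bound[where r = "q - p" and w = "\<lambda>u. nn_powr (l u) p * e u"])
    fix u assume u: "u \<in> B"
    show "nn_powr (l u) q * \<bar>e u\<bar> \<le> nn_powr (l u) (q - p) * \<bar>nn_powr (l u) p * e u\<bar>"
      using pq nn_powr_add[of "q - p" p "l u"] by (simp add: abs_mult)
  qed (use l a pq e in auto)
  then have sG: "?G summable_on B"
    by (simp add: finite_norm_def)
  have sf: "?f summable_on B"
    using fin by (simp add: finite_norm_def)
  have sf1: "?f summable_on ?B1" and sf2: "?f summable_on ?B2"
    by (rule summable_on_subset[OF sf]; blast)+
  have low: "?n u \<le> 4 * ?G u" if u: "u \<in> ?B3" for u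
  proof -
    have "1 / 2 \<le> a / (l u + a)"
      using u a by (simp add: field_simps)
    then have "(1 / 2)\<^sup>2 \<le> (a / (l u + a))\<^sup>2"
      by (rule power_mono) simp
    then have "?n u * (1/2)\<^sup>2 \<le> ?n u * (a / (l u + a))\<^sup>2"
      by (rule mult_left_mono) simp
    also have "\<dots> = ?G u"
      using pq nn_powr_square[of q "l u"]
      by (simp add: residual_coeff_def power_mult_distrib power_divide)
    finally show ?thesis by (simp add: power2_eq_square)
  qed
  have sG3: "(\<lambda>u. 4 * ?G u) summable_on ?B3"
    by (intro summable_on_cmult_right summable_on_subset[OF sG]) blast
  have sn3: "?n summable_on ?B3"
    by (rule summable_on_comparison_test[OF sG3]) (use low in auto)
  define S where "S = infsum ?n ?B3"
  have "S \<le> (\<Sum>\<^sub>\<infinity>u\<in>?B3. 4 * ?G u)"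
    unfolding S_def by (rule infsum_mono[OF sn3 sG3 low])
  also have "\<dots> = 4 * infsum ?G ?B3"
    by (intro infsum_cmult_right summable_on_subset[OF sG]) blast
  also have "\<dots> \<le> 4 * infsum ?G B"
    using sG by (intro mult_left_mono infsum_mono2 summable_on_subset[OF sG]) auto
  finally have S: "S \<le> 4 * (formal_norm B (residual_coeff l q e a))\<^sup>2"
    by (simp add: formal_norm_square)
  \<comment> \<open>Above the threshold \<open>l\<close> and \<open>l + a\<close> agree up to a
    factor 2. The first inequality yields summability of the integrand in the noise condition, so
    that its \<open>infsum\<close> is not the default value 0; the second bounds the data error by
    it.\<close>
  have high: "1 / l u * (e u)\<^sup>2 \<le> 4 * ?f u \<and> ?f u \<le> 1 / l u * (e u)\<^sup>2" if u: "u \<in> ?B1" for u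
  proof -
    have lu: "0 < l u" "a \<le> l u" using u a by auto
    have "(l u + a)\<^sup>2 \<le> (2 * l u)\<^sup>2" "(l u)\<^sup>2 \<le> (l u + a)\<^sup>2"
      using lu a by (intro power_mono; simp)+
    moreover have "0 < (l u + a)\<^sup>2"
      using lu a by simp
    ultimately have "1 / l u \<le> 4 * (l u / (l u + a)\<^sup>2)" "l u / (l u + a)\<^sup>2 \<le> 1 / l u"
      using lu(1) by (simp_all add: divide_le_eq le_divide_eq power2_eq_square[of "l u"] power2_eq_square[of "2 * l u"] del: zero_less_power2)
    then have "1 / l u * (e u)\<^sup>2 \<le> 4 * (l u / (l u + a)\<^sup>2) * (e u)\<^sup>2"
      "l u / (l u + a)\<^sup>2 * (e u)\<^sup>2 \<le> 1 / l u * (e u)\<^sup>2"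
      by (intro mult_right_mono; simp)+
    then show ?thesis
      using lu by (simp add: power_mult_distrib power_divide)
  qed
  have "(\<lambda>u. 1 / l u * (e u)\<^sup>2) summable_on ?B1"
    by (rule summable_on_comparison_test[OF summable_on_cmult_right[OF sf1, of 4]])
      (use high a in auto)
  then have "infsum ?f ?B1 \<le> (\<Sum>\<^sub>\<infinity>u\<in>?B1. 1 / l u * (e u)\<^sup>2)"
    using high by (intro infsum_mono sf1) auto
  then have "a powr (2 * q + 1) * infsum ?f ?B1 \<le> C * S"
    using noise mult_left_mono[of "infsum ?f ?B1" _ "a powr (2 * q + 1)"]
    unfolding S_def by fastforce
  \<comment> \<open>Below the threshold no noise condition enters: since \<open>q\<close> \<le>
    \<open>1/2\<close>, \<open>l\<close> is at most its power \<open>2 * q\<close> times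
    \<open>a powr (1 - 2 * q)\<close>.\<close>
  moreover have "a powr (2 * q + 1) * infsum ?f ?B2 \<le> S"
  proof -
    have le: "a powr (2 * q + 1) * ?f u \<le> ?n u" if u: "u \<in> ?B2" for u
    proof -
      have lu: "0 \<le> l u" "l u \<le> a" using u l by auto
      have "l u = nn_powr (l u) (2 * q + (1 - 2 * q))"
        using lu by (simp add: nn_powr_def)
      also have "\<dots> = nn_powr (l u) (2 * q) * nn_powr (l u) (1 - 2 * q)"
        using pq by (intro nn_powr_add) auto
      also have "\<dots> \<le> nn_powr (l u) (2 * q) * nn_powr a (1 - 2 * q)"
        using pq lu by (intro mult_left_mono nn_powr_mono) auto
      finally have "a powr (2 * q + 1) * l u
          \<le> nn_powr (l u) (2 * q) * (a powr (1 - 2 * q) * a powr (2 * q + 1))"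
        using a mult_left_mono[of "l u" _ "a powr (2 * q + 1)"] by (simp add: nn_powr_pos mult_ac)
      also have "a powr (1 - 2 * q) * a powr (2 * q + 1) = a\<^sup>2"
        using a by (simp flip: powr_add)
      finally have "a powr (2 * q + 1) * l u \<le> nn_powr (l u) (2 * q) * a\<^sup>2" .
      also have "\<dots> \<le> nn_powr (l u) (2 * q) * (l u + a)\<^sup>2"
        using lu a by (intro mult_left_mono power_mono) auto
      finally have "a powr (2 * q + 1) * (l u / (l u + a)\<^sup>2) \<le> nn_powr (l u) (2 * q)"
        using lu a by (simp add: divide_le_eq)
      then have "a powr (2 * q + 1) * (l u / (l u + a)\<^sup>2) * (e u)\<^sup>2 \<le> ?n u"
        by (rule mult_right_mono) simp
      then show ?thesis
        using lu by (simp add: power_mult_distrib power_divide mult.assoc)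
    qed
    have "a powr (2 * q + 1) * infsum ?f ?B2 = (\<Sum>\<^sub>\<infinity>u\<in>?B2. a powr (2 * q + 1) * ?f u)"
      using sf2 by (simp add: infsum_cmult_right)
    also have "\<dots> \<le> S"
      unfolding S_def
      by (rule infsum_mono_neutral[OF summable_on_cmult_right[OF sf2] sn3]) (use le l in auto)
    finally show ?thesis .
  qed
  moreover have "infsum ?f B = infsum ?f ?B1 + infsum ?f ?B2"
  proof -
    \<comment> \<open>The strict inequality in \<open>?B2\<close> makes the two frequency ranges
      disjoint.\<close>
    have "B = ?B1 \<union> ?B2" using l by force
    then show ?thesis
      using infsum_Un_disjoint[OF sf1 sf2] by force
  qed
  ultimately have "a powr (2 * q + 1) * infsum ?f B \<le> (C + 1) * S"
    by (simp add: algebra_simps)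
  also have "\<dots> \<le> (C + 1) * (4 * (formal_norm B (residual_coeff l q e a))\<^sup>2)"
    using S C by (intro mult_left_mono) auto
  finally have main: "a powr (2 * q + 1) * infsum ?f B
      \<le> (C + 1) * (4 * (formal_norm B (residual_coeff l q e a))\<^sup>2)" .
  \<comment> \<open>The squared prefactor of \<open>hd_coeff\<close> cancels the weight that the
    noise condition puts on the data error.\<close>
  have inv: "(a powr (- q - 1/2))\<^sup>2 * a powr (2 * q + 1) = 1"
    using a by (simp add: power2_eq_square flip: powr_add)
  have "(formal_norm B (\<lambda>u. sqrt (l u) / (l u + a) * e u))\<^sup>2
      = (a powr (- q - 1/2))\<^sup>2 * (a powr (2 * q + 1) * infsum ?f B)"
    using inv by (simp add: formal_norm_square mult.assoc[symmetric])
  also have "\<dots> \<le> (a powr (- q - 1/2))\<^sup>2 * ((C + 1) * (4 * (formal_norm B (residual_coeff l q e a))\<^sup>2))"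
    by (rule mult_left_mono[OF main]) simp
  also have "\<dots> = (2 * sqrt (C + 1) * hd_coeff B l q e a)\<^sup>2"
    using C by (simp add: hd_coeff_def power_mult_distrib)
  finally show "formal_norm B (\<lambda>u. sqrt (l u) / (l u + a) * e u) \<le> 2 * sqrt (C + 1) * hd_coeff B l q e a"
    by (rule power2_le_imp_le) (use C in \<open>simp add: hd_coeff_def\<close>)
qed

text \<open>The lower bound on \<open>P\<close> is a bound on \<open>a powr (1/2 - q)\<close>;
  raising it to the power \<rho> turns it into one on \<open>a powr\<close>\<mu>. The term with
  \<open>P\<close> decays at least as fast, because \<rho> \<le> \<open>1\<close> and
  \<open>h\<close> \<le> \<open>1\<close>.\<close>

lemma rate_from_discrepancy_bounds:
  fixes a c h k k' M P q \<kappa> \<mu> :: real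
  assumes pos: "0 < a" "0 < c" "0 < M" "0 \<le> k" "0 \<le> k'" and h: "0 < h" "h \<le> 1"
    and exps: "0 \<le> \<kappa>" "0 \<le> \<mu>" "q \<le> 1/2 - \<mu>"
    and lower: "c * a powr (1/2 - q) \<le> P" and upper: "P \<le> M * h powr \<kappa>"
    and err: "err \<le> k * P + k' * a powr \<mu>"
  shows "err \<le> (k * M + k' * (M / c) powr (2 * \<mu> / (1 - 2 * q))) * h powr (\<kappa> * (2 * \<mu> / (1 - 2 * q)))"
proof -
  define \<rho> where "\<rho> = 2 * \<mu> / (1 - 2 * q)"
  \<comment> \<open>For \<open>q = 1/2\<close> the hypotheses force \<mu> to be 0, and division by
    zero gives \<rho> the value 0, for which the three claims remain true.\<close>
  have \<rho>: "0 \<le> \<rho>" "\<rho> \<le> 1" "(1/2 - q) * \<rho> = \<mu>"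
    using exps by (cases "q = 1/2"; simp add: \<rho>_def field_simps)+
  have "a powr (1/2 - q) \<le> M / c * h powr \<kappa>"
    using lower upper pos by (simp add: field_simps)
  then have "(a powr (1/2 - q)) powr \<rho> \<le> (M / c * h powr \<kappa>) powr \<rho>"
    by (rule powr_mono2[OF \<rho>(1), rotated]) simp
  then have "a powr \<mu> \<le> (M / c) powr \<rho> * h powr (\<kappa> * \<rho>)"
    using pos h by (simp add: powr_powr powr_mult powr_divide \<rho>(3))
  then have "k' * a powr \<mu> \<le> k' * ((M / c) powr \<rho> * h powr (\<kappa> * \<rho>))"
    using pos by (intro mult_left_mono)
  moreover have "h powr \<kappa> \<le> h powr (\<kappa> * \<rho>)"
    using h exps \<rho> by (intro powr_mono') (auto simp: mult_left_le)
  then have "P \<le> M * h powr (\<kappa> * \<rho>)"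
    using upper mult_left_mono[of "h powr \<kappa>" "h powr (\<kappa> * \<rho>)" M] pos by linarith
  then have "k * P \<le> k * (M * h powr (\<kappa> * \<rho>))"
    using pos by (intro mult_left_mono)
  ultimately show ?thesis
    using err unfolding \<rho>_def[symmetric] by (simp add: algebra_simps)
qed

section \<open>Spectral coefficients of the operator\<close>

lemma eigval_eq:
  assumes "S u = l *\<^sub>R u" "u \<noteq> 0"
  shows "eigval S u = l"
  unfolding eigval_def using assms by (intro the_equality) auto

text \<open>\<open>D\<close> furnishes the adjoint and the powers of \<open>TstarT T\<close> in the
  source condition. All other computations use \<open>B\<close> and the singular vectors derived
  from it.\<close>

locale hilbert_operator =
  fixes T :: "'a::{real_inner,banach} \<Rightarrow> 'b::{real_inner,banach}"
    and B :: "'b set" and D :: "'a set"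
  assumes bounded: "bounded_linear T"
    and eigenbasis_B: "eigenbasis (TTstar T) B"
    and eigenbasis_D: "eigenbasis (TstarT T) D"
begin

sublocale T: bounded_linear T
  by (rule bounded)

abbreviation lam :: "'b \<Rightarrow> real" where
  "lam \<equiv> eigval (TTstar T)"

lemma
  shows B_orth: "pairwise orthogonal B" and B_unit: "\<And>u. u \<in> B \<Longrightarrow> norm u = 1"
    and B_dense: "closure (span B) = UNIV"
    and D_orth: "pairwise orthogonal D" and D_unit: "\<And>d. d \<in> D \<Longrightarrow> norm d = 1"
    and D_dense: "closure (span D) = UNIV"
  using eigenbasis_B eigenbasis_D by (auto simp: eigenbasis_def)

section \<open>The adjoint and bounds for the spectrum\<close>

lemma inner_adjoint: "T x \<bullet> y = x \<bullet> adjoint T y"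
  by (rule adjoint_exists_orthonormal_basis[OF bounded D_orth D_unit D_dense])

lemma bounded_linear_adjoint: "bounded_linear (adjoint T)"
proof
  show "adjoint T (x + y) = adjoint T x + adjoint T y" for x y
    by (rule vector_eq_rdot[THEN iffD1])
      (simp add: inner_add_left inner_add_right inner_commute[of _ "_::'a"] flip: inner_adjoint)
  show "adjoint T (r *\<^sub>R x) = r *\<^sub>R adjoint T x" for r x
    by (rule vector_eq_rdot[THEN iffD1])
      (simp add: inner_commute[of _ "_::'a"] flip: inner_adjoint)
  have "norm (adjoint T y) \<le> norm y * onorm T" for y
  proof (cases "adjoint T y = 0")
    case False
    have "norm (adjoint T y) * norm (adjoint T y) = T (adjoint T y) \<bullet> y"
      by (simp add: inner_adjoint power2_norm_eq_inner flip: power2_eq_square)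
    also have "\<dots> \<le> norm (T (adjoint T y)) * norm y"
      by (rule norm_cauchy_schwarz)
    also have "\<dots> \<le> onorm T * norm (adjoint T y) * norm y"
      by (intro mult_right_mono onorm bounded) simp
    finally have "norm (adjoint T y) * norm (adjoint T y) \<le> (norm y * onorm T) * norm (adjoint T y)"
      by (simp add: mult_ac)
    then show ?thesis
      by (rule mult_right_le_imp_le) (simp add: False)
  qed (simp add: onorm_pos_le[OF bounded])
  then show "\<exists>K. \<forall>x. norm (adjoint T x) \<le> norm x * K"
    by blast
qed

sublocale adj: bounded_linear "adjoint T"
  by (rule bounded_linear_adjoint)

lemma TTstar_eigen: "u \<in> B \<Longrightarrow> T (adjoint T u) = lam u *\<^sub>R u"
  using eigenbasis_B eigval_eq[of "TTstar T" u] unfolding eigenbasis_def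
  by (metis norm_zero zero_neq_one)

lemma TstarT_eigen: "d \<in> D \<Longrightarrow> adjoint T (T d) = eigval (TstarT T) d *\<^sub>R d"
  using eigenbasis_D eigval_eq[of "TstarT T" d] unfolding eigenbasis_def
  by (metis norm_zero zero_neq_one)

lemma inner_adjoint_basis: "u \<in> B \<Longrightarrow> adjoint T u \<bullet> adjoint T w = lam u * (u \<bullet> w)"
  by (simp add: TTstar_eigen flip: inner_adjoint)

lemma norm_adjoint_basis: "u \<in> B \<Longrightarrow> (norm (adjoint T u))\<^sup>2 = lam u"
  using B_unit by (simp add: power2_norm_eq_inner inner_adjoint_basis norm_eq_1)

lemma lam_nonneg: "u \<in> B \<Longrightarrow> 0 \<le> lam u"
  using norm_adjoint_basis[of u] by (metis zero_le_power2)

lemma sqrt_lam: "u \<in> B \<Longrightarrow> sqrt (lam u) = norm (adjoint T u)"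
  by (simp flip: norm_adjoint_basis)

lemma lam_le: "u \<in> B \<Longrightarrow> lam u \<le> (onorm T)\<^sup>2"
proof -
  assume u: "u \<in> B"
  have "norm (T (adjoint T u)) \<le> onorm T * norm (adjoint T u)"
    by (rule onorm[OF bounded])
  then have "norm (adjoint T u) * norm (adjoint T u) \<le> onorm T * norm (adjoint T u)"
    using u B_unit lam_nonneg[OF u] by (simp add: TTstar_eigen flip: norm_adjoint_basis power2_eq_square)
  then have "norm (adjoint T u) \<le> onorm T"
    using onorm_pos_le[OF bounded] by (cases "adjoint T u = 0") auto
  then show "lam u \<le> (onorm T)\<^sup>2"
    using power_mono[of "norm (adjoint T u)" "onorm T" 2] norm_adjoint_basis[OF u] by simp
qed

lemma eigval_TstarT_bounds:
  assumes "d \<in> D"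
  shows "0 \<le> eigval (TstarT T) d \<and> eigval (TstarT T) d \<le> (onorm T)\<^sup>2"
proof -
  have "eigval (TstarT T) d = d \<bullet> adjoint T (T d)"
    using assms D_unit by (simp add: TstarT_eigen norm_eq_1)
  also have "\<dots> = (norm (T d))\<^sup>2"
    by (simp add: power2_norm_eq_inner flip: inner_adjoint)
  finally show ?thesis
    using power_mono[OF onorm[OF bounded, of d], of 2] assms D_unit by simp
qed

text \<open>The singular vector belonging to \<open>u\<close>; it is \<open>0\<close> if \<open>lam u = 0\<close>.\<close>

definition sv :: "'b \<Rightarrow> 'a" where
  "sv u = (1 / sqrt (lam u)) *\<^sub>R adjoint T u"

lemma adjoint_basis: "u \<in> B \<Longrightarrow> adjoint T u = sqrt (lam u) *\<^sub>R sv u"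
  by (cases "adjoint T u = 0") (auto simp: sv_def sqrt_lam)

lemma norm_sv: "u \<in> B \<Longrightarrow> norm (sv u) = (if lam u = 0 then 0 else 1)"
  using norm_adjoint_basis[of u] by (auto simp: sv_def simp flip: sqrt_lam)

lemma sv_orth: "pairwise (\<lambda>u w. orthogonal (sv u) (sv w)) B"
  using B_orth by (auto simp: pairwise_def orthogonal_def sv_def inner_adjoint_basis)

lemma sv_inner_self: "u \<in> B \<Longrightarrow> sv u \<bullet> sv u = (if lam u = 0 then 0 else 1)"
  using norm_sv[of u] by (simp flip: power2_norm_eq_inner)

lemma inner_sv: "u \<in> B \<Longrightarrow> T x \<bullet> u = sqrt (lam u) * (x \<bullet> sv u)"
  by (simp add: inner_adjoint adjoint_basis)

lemma sv_orth_kernel: "T n = 0 \<Longrightarrow> n \<bullet> sv u = 0"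
  using inner_adjoint[of n u] by (simp add: sv_def)

lemma finite_norm_sv: "finite_norm B (\<lambda>u. x \<bullet> sv u)"
  unfolding finite_norm_def by (rule bessel_summable[OF sv_orth]) (simp add: norm_sv)

section \<open>Series of singular vectors\<close>

lemma sv_series_orth_kernel:
  assumes "((\<lambda>u. c u *\<^sub>R sv u) has_sum x) B" "T n = 0"
  shows "x \<bullet> n = 0"
proof -
  have "((\<lambda>u. n \<bullet> (c u *\<^sub>R sv u)) has_sum (n \<bullet> x)) B"
    by (rule has_sum_inner_left[OF assms(1)])
  then have "((\<lambda>u. 0) has_sum (n \<bullet> x)) B"
    using sv_orth_kernel[OF assms(2)] by simp
  then show ?thesis
    using has_sum_unique[OF _ has_sum_0_simp] by (simp add: inner_commute)
qed

lemma sv_series_summable: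
  assumes "finite_norm B c"
  shows "(\<lambda>u. c u *\<^sub>R sv u) summable_on B"
proof (rule orthogonal_series_summable)
  show "pairwise (\<lambda>u w. orthogonal (c u *\<^sub>R sv u) (c w *\<^sub>R sv w)) B"
    using sv_orth by (auto simp: pairwise_def orthogonal_def)
  have "(\<lambda>u. (c u)\<^sup>2) summable_on B"
    using assms by (simp add: finite_norm_def)
  then show "(\<lambda>u. (norm (c u *\<^sub>R sv u))\<^sup>2) summable_on B"
    by (rule summable_on_comparison_test) (auto simp: norm_sv)
qed

lemma sv_series_coeff:
  assumes "((\<lambda>u. c u *\<^sub>R sv u) has_sum x) B" "u \<in> B"
  shows "x \<bullet> sv u = (if lam u = 0 then 0 else c u)"
proof -
  have "sv u \<bullet> x = sv u \<bullet> (c u *\<^sub>R sv u)"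
    using sv_orth assms(2)
    by (intro orthogonal_series_inner[OF assms(1)]) (auto simp: pairwise_def orthogonal_def)
  then show ?thesis
    using assms(2) by (simp add: sv_inner_self inner_commute)
qed

text \<open>The series is the component of \<open>z\<close> in the closed span of the singular
  vectors, hence orthogonal to the kernel of \<open>T\<close>. The images of \<open>w\<close> and
  \<open>z\<close> have equal coefficients in \<open>B\<close>.\<close>

lemma kernel_complement_component:
  obtains w where "((\<lambda>u. (z \<bullet> sv u) *\<^sub>R sv u) has_sum w) B" "T w = T z"
proof -
  obtain w where w: "((\<lambda>u. (z \<bullet> sv u) *\<^sub>R sv u) has_sum w) B"
    using sv_series_summable[OF finite_norm_sv[of z]] by (auto simp: summable_on_def)
  have "T (w - z) = 0"
  proof (rule orthogonal_to_dense_eq_0[OF B_dense])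
    fix u assume u: "u \<in> B"
    show "T (w - z) \<bullet> u = 0"
      using sv_series_coeff[OF w u] u by (simp add: inner_sv inner_diff_left)
  qed
  then show thesis
    using that[OF w] by (simp add: T.diff)
qed

text \<open>Let \<open>w\<close> be the singular vector series of \<open>z\<close>. Then
  \<open>z - w\<close> lies in the kernel and is orthogonal to it, so \<open>w = z\<close> and
  Parseval applies. Errors in the domain space can thus be measured over \<open>B\<close>.\<close>

lemma formal_norm_sv:
  assumes "\<And>n. T n = 0 \<Longrightarrow> z \<bullet> n = 0"
  shows "formal_norm B (\<lambda>u. z \<bullet> sv u) = norm z"
proof -
  obtain w where w: "((\<lambda>u. (z \<bullet> sv u) *\<^sub>R sv u) has_sum w) B" "T w = T z"
    by (rule kernel_complement_component)
  have "T (z - w) = 0"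
    using w(2) by (simp add: T.diff)
  then have "(z - w) \<bullet> (z - w) = 0"
    using assms[of "z - w"] sv_series_orth_kernel[OF w(1), of "z - w"] by (simp add: inner_diff_left)
  then have "w = z" by simp
  have "((\<lambda>u. (norm ((z \<bullet> sv u) *\<^sub>R sv u))\<^sup>2) has_sum (norm z)\<^sup>2) B"
    using w(1) sv_orth unfolding \<open>w = z\<close>
    by (intro orthogonal_series_norm) (auto simp: pairwise_def orthogonal_def)
  moreover have "(norm ((z \<bullet> sv u) *\<^sub>R sv u))\<^sup>2 = (z \<bullet> sv u)\<^sup>2" if "u \<in> B" for u
    using norm_sv[OF that] by (auto split: if_splits)
  ultimately have "((\<lambda>u. (z \<bullet> sv u)\<^sup>2) has_sum (norm z)\<^sup>2) B"
    by (simp cong: has_sum_cong)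
  then show ?thesis
    unfolding formal_norm_def by (simp add: infsumI)
qed

text \<open>The power is defined through \<open>D\<close>, which may be unrelated to the singular
  vectors. Since \<open>sv u\<close> is an eigenvector of the symmetric \<open>TstarT T\<close> for
  \<open>lam u\<close>, only those \<open>d\<close> with that same eigenvalue have a component along
  it.\<close>

lemma op_powr_sv:
  assumes u: "u \<in> B" "0 < lam u" and s: "0 \<le> s"
  shows "op_powr (TstarT T) D s \<omega> \<bullet> sv u = lam u powr s * (\<omega> \<bullet> sv u)"
proof -
  let ?m = "eigval (TstarT T)"
  have "adjoint T (T (sv u)) = lam u *\<^sub>R sv u"
    using u by (simp add: sv_def T.scaleR adj.scaleR TTstar_eigen)
  then have eig: "?m d = lam u" if "d \<in> D" "d \<bullet> sv u \<noteq> 0" for d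
  proof -
    have "?m d * (d \<bullet> sv u) = adjoint T (T d) \<bullet> sv u"
      using that by (simp add: TstarT_eigen)
    also have "\<dots> = d \<bullet> adjoint T (T (sv u))"
      by (metis inner_adjoint inner_commute)
    also have "\<dots> = lam u * (d \<bullet> sv u)"
      using \<open>adjoint T (T (sv u)) = lam u *\<^sub>R sv u\<close> by simp
    finally show ?thesis using that by simp
  qed
  have "(\<lambda>d. (\<omega> \<bullet> d)\<^sup>2) summable_on D"
    using D_unit by (intro bessel_summable) (auto simp: D_orth)
  then have "finite_norm D (\<lambda>d. \<omega> \<bullet> d)"
    by (simp add: finite_norm_def)
  \<comment> \<open>The eigenvalues are bounded, so the series defining the power converges;
    otherwise \<open>op_powr\<close> would be the default 0.\<close>
  then have "finite_norm D (\<lambda>d. nn_powr (?m d) s * (\<omega> \<bullet> d))"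
  proof (rule finite_norm_bound[where c = "nn_powr ((onorm T)\<^sup>2) s"])
    fix d assume "d \<in> D"
    then have "nn_powr (?m d) s \<le> nn_powr ((onorm T)\<^sup>2) s"
      using eigval_TstarT_bounds s by (intro nn_powr_mono) auto
    then show "\<bar>nn_powr (?m d) s * (\<omega> \<bullet> d)\<bar> \<le> nn_powr ((onorm T)\<^sup>2) s * \<bar>\<omega> \<bullet> d\<bar>"
      by (simp add: abs_mult mult_right_mono)
  qed simp
  then have "(\<lambda>d. (nn_powr (?m d) s * (\<omega> \<bullet> d)) *\<^sub>R d) summable_on D"
    using D_orth D_unit by (intro orthonormal_scaled_summable) (auto simp: finite_norm_def)
  then have "((\<lambda>d. (nn_powr (?m d) s * (\<omega> \<bullet> d)) *\<^sub>R d) has_sum op_powr (TstarT T) D s \<omega>) D"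
    unfolding op_powr_def by (rule has_sum_infsum)
  from has_sum_inner_left[OF this, of "sv u"]
  have 1: "((\<lambda>d. nn_powr (?m d) s * (\<omega> \<bullet> d) * (d \<bullet> sv u)) has_sum (sv u \<bullet> op_powr (TstarT T) D s \<omega>)) D"
    by (simp add: inner_commute)
  have "((\<lambda>d. (\<omega> \<bullet> d) *\<^sub>R d) has_sum \<omega>) D"
    by (rule orthonormal_expansion[OF D_orth D_unit D_dense])
  from has_sum_cmult_right[OF has_sum_inner_left[OF this, of "sv u"], of "lam u powr s"]
  have 2: "((\<lambda>d. lam u powr s * ((\<omega> \<bullet> d) * (d \<bullet> sv u))) has_sum (lam u powr s * (\<omega> \<bullet> sv u))) D"
    by (simp add: inner_commute)
  have "nn_powr (?m d) s * (\<omega> \<bullet> d) * (d \<bullet> sv u) = lam u powr s * ((\<omega> \<bullet> d) * (d \<bullet> sv u))"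
    if "d \<in> D" for d
    using eig[OF that] u(2) by (cases "d \<bullet> sv u = 0") (auto simp: nn_powr_pos)
  from has_sum_cong[THEN iffD2, OF this 2]
  show ?thesis
    using has_sum_unique[OF 1] by (simp add: inner_commute)
qed

section \<open>The projection and the Moore-Penrose inverse\<close>

lemma orth_proj_range_eq:
  assumes r: "r \<in> range T" and s: "s \<in> orthogonal_comp (range T)"
  shows "orth_proj (closure (range T)) (r + s) = r"
proof -
  have closed: "orthogonal_comp (closure (range T)) = orthogonal_comp (range T)"
  proof
    show "orthogonal_comp (closure (range T)) \<subseteq> orthogonal_comp (range T)"
      by (rule orthogonal_comp_anti_mono[OF closure_subset])
    show "orthogonal_comp (range T) \<subseteq> orthogonal_comp (closure (range T))"
    proof
      fix x assume x: "x \<in> orthogonal_comp (range T)"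
      have "closed {z. z \<bullet> x = 0}"
        by (intro closed_Collect_eq continuous_intros)
      then have "closure (range T) \<subseteq> {z. z \<bullet> x = 0}"
        using x by (intro closure_minimal) (auto simp: orthogonal_comp_def orthogonal_def)
      then show "x \<in> orthogonal_comp (closure (range T))"
        by (auto simp: orthogonal_comp_def orthogonal_def)
    qed
  qed
  show ?thesis
    unfolding orth_proj_def
  proof (rule the_equality)
    show "r \<in> closure (range T) \<and> r + s - r \<in> orthogonal_comp (closure (range T))"
      using r s closure_subset[of "range T"] unfolding closed by auto
    fix z assume z: "z \<in> closure (range T) \<and> r + s - z \<in> orthogonal_comp (closure (range T))"
    \<comment> \<open>Two candidates for the projection differ by a vector that is orthogonal to
      both of them, hence to itself.\<close>
    have "s - (r + s - z) \<in> orthogonal_comp (closure (range T))"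
      using z s unfolding closed by (intro subspace_diff[OF subspace_orthogonal_comp, of s]) auto
    then have "z \<bullet> (z - r) = 0" "r \<bullet> (z - r) = 0"
      using z r closure_subset[of "range T"] by (auto simp: orthogonal_comp_def orthogonal_def)
    then have "(z - r) \<bullet> (z - r) = 0"
      by (simp add: inner_diff_left)
    then show "z = r" by simp
  qed
qed

text \<open>Let \<open>w\<close> be the kernel-orthogonal component of a preimage \<open>z\<close>.
  Pythagoras in the data space identifies the least-squares solutions with the preimages of
  \<open>T z\<close>; Pythagoras in the domain makes \<open>w\<close> the unique one of minimal
  norm.\<close>

lemma
  assumes "y \<in> mp_domain T"
  shows T_mp_inverse: "T (mp_inverse T y) = orth_proj (closure (range T)) y"
    and mp_inverse_orth_kernel: "T n = 0 \<Longrightarrow> mp_inverse T y \<bullet> n = 0"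
proof -
  obtain z s where y: "y = T z + s" and s: "s \<in> orthogonal_comp (range T)"
    using assms unfolding mp_domain_def by auto
  obtain w where w: "((\<lambda>u. (z \<bullet> sv u) *\<^sub>R sv u) has_sum w) B" "T w = T z"
    by (rule kernel_complement_component)
  have w_orth: "w \<bullet> n = 0" if "T n = 0" for n
    by (rule sv_series_orth_kernel[OF w(1) that])
  have dist: "(norm (T x - y))\<^sup>2 = (norm (T (x - w)))\<^sup>2 + (norm s)\<^sup>2" for x
  proof -
    have "orthogonal (T (x - w)) (- s)"
      using s unfolding orthogonal_comp_def orthogonal_def by simp
    from norm_add_Pythagorean[OF this] show ?thesis
      by (simp add: y T.diff w(2) algebra_simps)
  qed
  have ls: "least_squares_solution T y x \<longleftrightarrow> T x = T w" for x
  proof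
    assume "least_squares_solution T y x"
    then have "norm (T x - y) \<le> norm (T w - y)"
      unfolding least_squares_solution_def by blast
    then have "(norm (T x - y))\<^sup>2 \<le> (norm (T w - y))\<^sup>2"
      by (rule power_mono) simp
    then show "T x = T w"
      unfolding dist by (simp add: T.diff)
  next
    assume x: "T x = T w"
    have "norm (T x - y) \<le> norm (T v - y)" for v
      by (rule power2_le_imp_le) (simp_all add: dist T.diff x)
    then show "least_squares_solution T y x"
      unfolding least_squares_solution_def by blast
  qed
  have pyth: "(norm x)\<^sup>2 = (norm w)\<^sup>2 + (norm (x - w))\<^sup>2" if "T x = T w" for x
    using norm_add_Pythagorean[of w "x - w"] w_orth[of "x - w"] that
    by (simp add: orthogonal_def T.diff)
  have "mp_inverse T y = w"
    unfolding mp_inverse_def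
  proof (rule the_equality)
    have "norm w \<le> norm v" if "T v = T w" for v
      by (rule power2_le_imp_le) (simp_all add: pyth[OF that])
    then show "least_squares_solution T y w \<and> (\<forall>v. least_squares_solution T y v \<longrightarrow> norm w \<le> norm v)"
      by (simp add: ls)
    fix x assume "least_squares_solution T y x \<and> (\<forall>v. least_squares_solution T y v \<longrightarrow> norm x \<le> norm v)"
    then have x: "T x = T w" "norm x \<le> norm w"
      by (auto simp: ls)
    have "(norm x)\<^sup>2 \<le> (norm w)\<^sup>2"
      using x(2) by (rule power_mono) simp
    then show "x = w"
      using pyth[OF x(1)] by simp
  qed
  then show "T (mp_inverse T y) = orth_proj (closure (range T)) y"
    and "T n = 0 \<Longrightarrow> mp_inverse T y \<bullet> n = 0"
    using w_orth w(2) orth_proj_range_eq[OF _ s, of "T z"] by (simp_all add: y)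
qed

section \<open>Projection, Tikhonov solution and discrepancy in spectral coefficients\<close>

lemma formal_proj_basis:
  assumes "u \<in> B"
  shows "formal_proj T z u = (if lam u = 0 then 0 else z u)"
proof (cases "lam u = 0")
  case True
  then have "adjoint T u = 0"
    using norm_adjoint_basis[OF assms] by simp
  have "closed {z. z \<bullet> u = 0}"
    by (intro closed_Collect_eq continuous_intros)
  then have "closure (range T) \<subseteq> {z. z \<bullet> u = 0}"
    using \<open>adjoint T u = 0\<close> by (intro closure_minimal) (auto simp: inner_adjoint)
  moreover have "u \<bullet> u \<noteq> 0"
    using B_unit[OF assms] by (simp add: norm_eq_1)
  ultimately show ?thesis
    using True by (auto simp: formal_proj_def)
next
  case False
  have "T ((1 / lam u) *\<^sub>R adjoint T u) = u"
    using False assms by (simp add: T.scaleR TTstar_eigen)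
  then have "u \<in> closure (range T)"
    using closure_subset by (metis rangeI subsetD)
  then show ?thesis
    using False by (simp add: formal_proj_def)
qed

text \<open>Applying \<open>TstarT T\<close> plus \<open>a\<close> times the identity to the
  filtered series term by term returns the series of \<open>formal_adjoint T B z\<close>.
  Injectivity of that operator then identifies the sum with the value of \<open>inv\<close>.\<close>

lemma tikhonov_series:
  assumes p: "0 \<le> p" "p \<le> 1/2" and a: "0 < a"
    and z: "finite_norm B (\<lambda>u. nn_powr (lam u) p * z u)"
  shows "((\<lambda>u. (sqrt (lam u) / (lam u + a) * z u) *\<^sub>R sv u) has_sum tikhonov T B z a) B"
proof -
  let ?G = "\<lambda>x. adjoint T (T x) + a *\<^sub>R x"
  \<comment> \<open>Here \<open>p\<close> \<le> \<open>1/2\<close> is what makes the formal adjoint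
    of \<open>z\<close> a genuine vector: the spectrum is bounded, so the extra power
    \<open>1/2 - p\<close> is harmless.\<close>
  have fin: "finite_norm B (\<lambda>u. sqrt (lam u) * z u)"
  proof (rule finite_norm_bound[OF z, of "nn_powr ((onorm T)\<^sup>2) (1/2 - p)"])
    fix u assume u: "u \<in> B"
    have "sqrt (lam u) = nn_powr (lam u) (1/2 - p + p)"
      using lam_nonneg[OF u] by (simp add: nn_powr_def powr_half_sqrt)
    also have "\<dots> = nn_powr (lam u) (1/2 - p) * nn_powr (lam u) p"
      using p by (intro nn_powr_add) auto
    also have "\<dots> \<le> nn_powr ((onorm T)\<^sup>2) (1/2 - p) * nn_powr (lam u) p"
      using lam_nonneg[OF u] lam_le[OF u] p by (intro mult_right_mono nn_powr_mono) auto
    finally show "\<bar>sqrt (lam u) * z u\<bar> \<le> nn_powr ((onorm T)\<^sup>2) (1/2 - p) * \<bar>nn_powr (lam u) p * z u\<bar>"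
      using lam_nonneg[OF u]
      by (simp add: abs_mult mult_right_mono mult.assoc[symmetric])
  qed simp
  then obtain b where b: "((\<lambda>u. (sqrt (lam u) * z u) *\<^sub>R sv u) has_sum b) B"
    using sv_series_summable by (auto simp: summable_on_def)
  have fa: "formal_adjoint T B z = b"
    unfolding formal_adjoint_def
  proof (rule infsumI)
    show "((\<lambda>u. z u *\<^sub>R adjoint T u) has_sum b) B"
      using b by (simp add: adjoint_basis mult.commute cong: has_sum_cong)
  qed
  have "finite_norm B (\<lambda>u. sqrt (lam u) / (lam u + a) * z u)"
  proof (rule finite_norm_bound[OF fin, of "1 / a"])
    fix u assume u: "u \<in> B"
    have "1 / (lam u + a) \<le> 1 / a"
      using lam_nonneg[OF u] a by (intro divide_left_mono) auto
    from mult_right_mono[OF this, of "\<bar>sqrt (lam u) * z u\<bar>"]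
    show "\<bar>sqrt (lam u) / (lam u + a) * z u\<bar> \<le> 1 / a * \<bar>sqrt (lam u) * z u\<bar>"
      using lam_nonneg[OF u] a by (simp add: abs_mult)
  qed (use a in simp)
  then obtain x where x: "((\<lambda>u. (sqrt (lam u) / (lam u + a) * z u) *\<^sub>R sv u) has_sum x) B"
    using sv_series_summable by (auto simp: summable_on_def)
  have "bounded_linear ?G"
    by (intro bounded_linear_add bounded_linear_compose[OF bounded_linear_adjoint bounded]
        bounded_linear_scaleR_right)
  from has_sum_bounded_linear[OF this x]
  have "((\<lambda>u. ?G ((sqrt (lam u) / (lam u + a) * z u) *\<^sub>R sv u)) has_sum ?G x) B" .
  moreover have "?G ((sqrt (lam u) / (lam u + a) * z u) *\<^sub>R sv u) = (sqrt (lam u) * z u) *\<^sub>R sv u"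
    if u: "u \<in> B" for u
  proof -
    have 1: "?G (sv u) = (lam u + a) *\<^sub>R sv u"
      using u by (simp add: sv_def T.scaleR adj.scaleR TTstar_eigen add_divide_distrib scaleR_add_left)
    have 2: "?G (c *\<^sub>R sv u) = c *\<^sub>R ?G (sv u)" for c
      by (simp add: T.scaleR adj.scaleR scaleR_add_right)
    have 3: "sqrt (lam u) / (lam u + a) * z u * (lam u + a) = sqrt (lam u) * z u"
      using lam_nonneg[OF u] a by simp
    show ?thesis
      unfolding 2 1 unfolding scaleR_scaleR 3 ..
  qed
  ultimately have "((\<lambda>u. (sqrt (lam u) * z u) *\<^sub>R sv u) has_sum ?G x) B"
    by (simp cong: has_sum_cong)
  then have Gx: "?G x = b"
    using has_sum_unique[OF b] by simp
  have "inj ?G"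
  proof (rule injI)
    fix v w assume "?G v = ?G w"
    then have "?G (v - w) = 0"
      by (simp add: T.diff adj.diff algebra_simps)
    \<comment> \<open>Pairing with the difference splits the equation into two nonnegative terms,
      one of them \<open>a\<close> times its squared norm.\<close>
    then have "(v - w) \<bullet> ?G (v - w) = 0"
      by (simp only: inner_zero_right)
    then have "(norm (T (v - w)))\<^sup>2 + a * (norm (v - w))\<^sup>2 = 0"
      by (simp only: inner_add_right inner_scaleR_right power2_norm_eq_inner inner_adjoint)
    then have "a * (norm (v - w))\<^sup>2 \<le> 0"
      by (smt (verit) zero_le_power2)
    then show "v = w"
      using a by (simp add: mult_le_0_iff)
  qed
  then have "inv ?G (?G x) = x"
    by (rule inv_f_f)
  then have "tikhonov T B z a = x"
    unfolding tikhonov_def fa Gx .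
  then show ?thesis using x by simp
qed

lemma tikhonov_sv:
  assumes "0 \<le> p" "p \<le> 1/2" "0 < a" "finite_norm B (\<lambda>u. nn_powr (lam u) p * z u)" "u \<in> B"
  shows "tikhonov T B z a \<bullet> sv u = sqrt (lam u) / (lam u + a) * z u"
  using sv_series_coeff[OF tikhonov_series[OF assms(1-4)] assms(5)] by simp

text \<open>The residual has coefficients \<open>- (a / (lam u + a)) * z u\<close>, also at
  eigenvalue 0, and the sign disappears on squaring.\<close>

lemma psi_HD_eq_hd_coeff:
  assumes "0 \<le> p" "p \<le> 1/2" "0 < a" "finite_norm B (\<lambda>u. nn_powr (lam u) p * z u)"
  shows "psi_HD T B q z a = hd_coeff B lam q z a"
proof -
  have "(formal_powr (TTstar T) q (\<lambda>u. T (tikhonov T B z a) \<bullet> u - z u) u)\<^sup>2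
      = (residual_coeff lam q z a u)\<^sup>2" if u: "u \<in> B" for u
  proof -
    have "T (tikhonov T B z a) \<bullet> u - z u = (lam u / (lam u + a) - 1) * z u"
      using u lam_nonneg[OF u]
      by (simp add: inner_sv tikhonov_sv[OF assms] left_diff_distrib)
    also have "lam u / (lam u + a) - 1 = - (a / (lam u + a))"
      using lam_nonneg[OF u] assms(3) by (simp add: field_simps)
    finally show ?thesis
      by (simp add: formal_powr_def residual_coeff_def power_mult_distrib power_divide)
  qed
  then show ?thesis
    unfolding psi_HD_def hd_coeff_def formal_norm_def by (simp cong: infsum_cong)
qed

end

section \<open>Bounds for the discrepancy functional and the total error\<close>

text \<open>The noise, its class constant and the regularisation parameter stay variables of the
  lemmas, so that uniformity in them remains visible.\<close>

locale tikhonov_problem = hilbert_operator T B D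
  for T :: "'a::{real_inner,banach} \<Rightarrow> 'b::{real_inner,banach}" and B D +
  fixes y :: 'b and \<omega> :: 'a and p q \<mu> :: real
  assumes y: "y \<in> mp_domain T"
    and p: "0 \<le> p" "p \<le> 1/2" and pq: "p \<le> q" "q \<le> p + 1" and q: "q \<le> 1/2 - \<mu>"
    and \<mu>: "0 \<le> \<mu>" "\<mu> \<le> 1"
    and source: "mp_inverse T y = op_powr (TstarT T) D \<mu> \<omega>"
begin

definition exact :: "'b \<Rightarrow> real" where
  "exact u = orth_proj (closure (range T)) y \<bullet> u"

text \<open>The norm of the component of \<omega> orthogonal to the kernel of
  \<open>T\<close>.\<close>

definition source_norm :: real where
  "source_norm = formal_norm B (\<lambda>u. \<omega> \<bullet> sv u)"

lemma noisy_data_eq: "noisy_data T y e = (\<lambda>u. exact u + e u)"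
  by (simp add: noisy_data_def exact_def)

lemma formal_powr_eq: "formal_powr (TTstar T) s e = (\<lambda>u. nn_powr (lam u) s * e u)"
  by (simp add: formal_powr_def)

lemma exact_eq: "u \<in> B \<Longrightarrow> exact u = sqrt (lam u) * (mp_inverse T y \<bullet> sv u)"
  by (simp add: exact_def inner_sv flip: T_mp_inverse[OF y])

lemma solution_coeff_bound:
  assumes "u \<in> B"
  shows "\<bar>mp_inverse T y \<bullet> sv u\<bar> \<le> nn_powr (lam u) \<mu> * \<bar>\<omega> \<bullet> sv u\<bar>"
proof (cases "lam u = 0")
  case True
  then have "sv u = 0" by (simp add: sv_def)
  then show ?thesis by simp
next
  case False
  then have "0 < lam u" using lam_nonneg[OF assms] by simp
  then show ?thesis
    using op_powr_sv[OF assms _ \<mu>(1)] by (simp add: source nn_powr_pos abs_mult)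
qed

text \<open>The exponent collects \<open>q\<close> from the functional, \<open>1/2\<close> from the
  operator and \<mu> from the source condition.\<close>

lemma exact_bound:
  assumes "u \<in> B"
  shows "nn_powr (lam u) q * \<bar>exact u\<bar> \<le> nn_powr (lam u) (q + 1/2 + \<mu>) * \<bar>\<omega> \<bullet> sv u\<bar>"
proof -
  have "sqrt (lam u) = nn_powr (lam u) (1/2)"
    using lam_nonneg[OF assms] by (simp add: nn_powr_def powr_half_sqrt)
  then have "nn_powr (lam u) q * \<bar>exact u\<bar>
      = nn_powr (lam u) (q + 1/2) * \<bar>mp_inverse T y \<bullet> sv u\<bar>"
    using assms p pq nn_powr_add[of q "1/2" "lam u"] by (simp add: exact_eq abs_mult)
  also have "\<dots> \<le> nn_powr (lam u) (q + 1/2) * (nn_powr (lam u) \<mu> * \<bar>\<omega> \<bullet> sv u\<bar>)"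
    by (intro mult_left_mono solution_coeff_bound assms) simp
  also have "\<dots> = nn_powr (lam u) (q + 1/2 + \<mu>) * \<bar>\<omega> \<bullet> sv u\<bar>"
    using p pq \<mu> nn_powr_add[of "q + 1/2" \<mu> "lam u"] by simp
  finally show ?thesis .
qed

lemma exact_residual:
  assumes "0 < a"
  shows "finite_norm B (residual_coeff lam q exact a)" "hd_coeff B lam q exact a \<le> source_norm * a powr \<mu>"
proof -
  note hyps = lam_nonneg assms _ _ finite_norm_sv[of \<omega>] exact_bound
  show "finite_norm B (residual_coeff lam q exact a)"
    by (rule finite_residual_bound[OF hyps]) (use p pq q \<mu> in auto)
  have "hd_coeff B lam q exact a \<le> a powr (q + 1/2 + \<mu> - q - 1/2) * source_norm"
    unfolding source_norm_def by (rule hd_coeff_bound[OF hyps]) (use p pq q \<mu> in auto)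
  then show "hd_coeff B lam q exact a \<le> source_norm * a powr \<mu>"
    by (simp add: mult.commute)
qed

lemma noise_residual:
  assumes "0 < a" and e: "finite_norm B (\<lambda>u. nn_powr (lam u) p * e u)"
  shows "finite_norm B (residual_coeff lam q e a)"
    "hd_coeff B lam q e a \<le> a powr (- p - 1/2) * formal_norm B (\<lambda>u. nn_powr (lam u) p * e u)"
proof -
  have "nn_powr (lam u) q * \<bar>e u\<bar> \<le> nn_powr (lam u) (q - p) * \<bar>nn_powr (lam u) p * e u\<bar>" for u
    using p pq nn_powr_add[of "q - p" p "lam u"] by (simp add: abs_mult)
  note hyps = lam_nonneg assms(1) _ _ e this
  show "finite_norm B (residual_coeff lam q e a)"
    by (rule finite_residual_bound[OF hyps]) (use p pq in auto)
  have "hd_coeff B lam q e a \<le> a powr (q - p - q - 1/2) * formal_norm B (\<lambda>u. nn_powr (lam u) p * e u)"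
    by (rule hd_coeff_bound[OF hyps]) (use p pq in auto)
  then show "hd_coeff B lam q e a \<le> a powr (- p - 1/2) * formal_norm B (\<lambda>u. nn_powr (lam u) p * e u)"
    by simp
qed

lemma finite_noisy:
  assumes "finite_norm B (\<lambda>u. nn_powr (lam u) p * e u)"
  shows "finite_norm B (\<lambda>u. nn_powr (lam u) p * (exact u + e u))"
proof -
  have "finite_norm B (\<lambda>u. nn_powr (lam u) p * exact u)"
  proof (rule finite_norm_bound[OF finite_norm_sv[of "mp_inverse T y"]])
    fix u assume u: "u \<in> B"
    have "nn_powr (lam u) p * sqrt (lam u) \<le> nn_powr ((onorm T)\<^sup>2) p * sqrt ((onorm T)\<^sup>2)"
      using lam_nonneg[OF u] lam_le[OF u] p by (intro mult_mono nn_powr_mono real_sqrt_le_mono) auto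
    then show "\<bar>nn_powr (lam u) p * exact u\<bar>
        \<le> nn_powr ((onorm T)\<^sup>2) p * sqrt ((onorm T)\<^sup>2) * \<bar>mp_inverse T y \<bullet> sv u\<bar>"
      using u lam_nonneg[OF u] by (simp add: exact_eq abs_mult mult_right_mono mult.assoc[symmetric])
  qed simp
  from finite_norm_add[OF this assms] show ?thesis
    by (simp add: distrib_left)
qed

lemma psi_HD_eq:
  assumes "0 < a" "finite_norm B (\<lambda>u. nn_powr (lam u) p * e u)"
  shows "psi_HD T B q (noisy_data T y e) a = hd_coeff B lam q (\<lambda>u. exact u + e u) a"
  unfolding noisy_data_eq by (rule psi_HD_eq_hd_coeff[OF p assms(1) finite_noisy[OF assms(2)]])

lemma psi_HD_upper_bound:
  assumes "0 < a" "finite_norm B (\<lambda>u. nn_powr (lam u) p * e u)"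
  shows "psi_HD T B q (noisy_data T y e) a
    \<le> source_norm * a powr \<mu> + a powr (- p - 1/2) * formal_norm B (\<lambda>u. nn_powr (lam u) p * e u)"
  unfolding psi_HD_eq[OF assms]
  using hd_coeff_triangle[OF exact_residual(1)[OF assms(1)] noise_residual(1)[OF assms]]
    exact_residual(2)[OF assms(1)] noise_residual(2)[OF assms] by linarith

text \<open>The assumption \<open>small\<close> keeps the noise at the coordinate \<open>u\<close>
  below half of the exact coefficient, so the noisy coefficient retains at least the other half.
  That one coordinate then bounds the functional from below.\<close>

lemma psi_HD_lower_bound:
  assumes a: "0 < a" "a < (onorm T)\<^sup>2" and e: "finite_norm B (\<lambda>u. nn_powr (lam u) p * e u)"
    and u: "u \<in> B"
    and small: "2 * (nn_powr ((onorm T)\<^sup>2) (q - p) * formal_norm B (\<lambda>u. nn_powr (lam u) p * e u))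
      \<le> nn_powr (lam u) q * \<bar>exact u\<bar>"
  shows "nn_powr (lam u) q * \<bar>exact u\<bar> / (4 * (onorm T)\<^sup>2) * a powr (1/2 - q)
    \<le> psi_HD T B q (noisy_data T y e) a"
proof -
  have "nn_powr (lam u) q * \<bar>e u\<bar> = nn_powr (lam u) (q - p) * \<bar>nn_powr (lam u) p * e u\<bar>"
    using p pq nn_powr_add[of "q - p" p "lam u"] by (simp add: abs_mult)
  also have "\<dots> \<le> nn_powr ((onorm T)\<^sup>2) (q - p) * formal_norm B (\<lambda>u. nn_powr (lam u) p * e u)"
    using u lam_nonneg[OF u] lam_le[OF u] pq
    by (intro mult_mono nn_powr_mono formal_norm_coord[OF e]) auto
  finally have "2 * (nn_powr (lam u) q * \<bar>e u\<bar>) \<le> nn_powr (lam u) q * \<bar>exact u\<bar>"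
    using small by linarith
  moreover have "nn_powr (lam u) q * \<bar>exact u\<bar> \<le> nn_powr (lam u) q * (\<bar>exact u + e u\<bar> + \<bar>e u\<bar>)"
    by (intro mult_left_mono) auto
  ultimately have "nn_powr (lam u) q * \<bar>exact u\<bar> / 2 \<le> nn_powr (lam u) q * \<bar>exact u + e u\<bar>"
    by (simp add: distrib_left)
  then have "nn_powr (lam u) q * \<bar>exact u\<bar> / 2 * (1 / (2 * (onorm T)\<^sup>2) * a powr (1/2 - q))
      \<le> nn_powr (lam u) q * \<bar>exact u + e u\<bar> * (1 / (2 * (onorm T)\<^sup>2) * a powr (1/2 - q))"
    by (rule mult_right_mono) simp
  then have "nn_powr (lam u) q * \<bar>exact u\<bar> / (4 * (onorm T)\<^sup>2) * a powr (1/2 - q)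
      \<le> nn_powr (lam u) q * \<bar>exact u + e u\<bar> / (2 * (onorm T)\<^sup>2) * a powr (1/2 - q)"
    by simp
  also have "\<dots> \<le> hd_coeff B lam q (\<lambda>u. exact u + e u) a"
    using a u lam_nonneg[OF u] lam_le[OF u]
    by (intro hd_coeff_lower_bound finite_residual_add exact_residual noise_residual e) auto
  finally show ?thesis
    by (simp add: psi_HD_eq[OF a(1) e])
qed

text \<open>Along \<open>sv u\<close> the error is the filtered projected noise plus the residual
  filter applied to the solution. The noise condition controls the first part by the functional of
  the noise, the source condition the second.\<close>

lemma error_bound:
  assumes a: "0 < a" "a < (onorm T)\<^sup>2" and e: "finite_norm B (\<lambda>u. nn_powr (lam u) p * e u)"
    and C: "0 < C" and noise: "formal_proj T e \<in> noise_class T B (2 * q) C"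
  shows "norm (tikhonov T B (noisy_data T y e) a - mp_inverse T y)
    \<le> 2 * sqrt (C + 1) * psi_HD T B q (noisy_data T y e) a
      + (2 * sqrt (C + 1) + 1) * source_norm * a powr \<mu>"
proof -
  let ?z = "\<lambda>u. exact u + e u" and ?x = "mp_inverse T y"
  let ?e = "formal_proj T e"
  let ?data = "\<lambda>u. sqrt (lam u) / (lam u + a) * ?e u"
  let ?approx = "residual_coeff lam 0 (\<lambda>u. - (?x \<bullet> sv u)) a"
  have lam: "\<And>u. u \<in> B \<Longrightarrow> 0 \<le> lam u \<and> lam u \<le> (onorm T)\<^sup>2"
    using lam_nonneg lam_le by blast
  have e_le: "\<bar>?e u\<bar> \<le> \<bar>e u\<bar>" if "u \<in> B" for u
    by (simp add: formal_proj_basis[OF that])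
  have fe: "finite_norm B (\<lambda>u. nn_powr (lam u) p * ?e u)"
    by (rule finite_norm_bound[OF e, of 1]) (auto simp: abs_mult intro!: mult_left_mono e_le)
  have "q \<le> 1/2"
    using q \<mu> by simp
  have cond: "a powr (2 * q + 1) * (\<Sum>\<^sub>\<infinity>u\<in>{u\<in>B. a \<le> lam u \<and> lam u \<le> (onorm T)\<^sup>2}. 1 / lam u * (?e u)\<^sup>2)
      \<le> C * (\<Sum>\<^sub>\<infinity>u\<in>{u\<in>B. 0 \<le> lam u \<and> lam u \<le> a}. nn_powr (lam u) (2 * q) * (?e u)\<^sup>2)"
    using noise a unfolding noise_class_def spec_integral_def by blast
  note hyps = lam a(1) p(1) pq(1) \<open>q \<le> 1/2\<close> pq(2) C fe cond
  have "formal_norm B ?data \<le> 2 * sqrt (C + 1) * hd_coeff B lam q ?e a"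
    by (rule data_error_le_hd_coeff[OF hyps])
  also have "hd_coeff B lam q ?e a \<le> hd_coeff B lam q e a"
    by (rule hd_coeff_mono[OF noise_residual(1)[OF a(1) e] e_le])
  \<comment> \<open>The noise is the noisy data minus the exact data; this replaces the unknown
    functional of the noise by the computable one.\<close>
  also have "hd_coeff B lam q e a \<le> hd_coeff B lam q ?z a + hd_coeff B lam q exact a"
  proof -
    have "residual_coeff lam q (\<lambda>u. - exact u) a = (\<lambda>u. - residual_coeff lam q exact a u)"
      by (simp add: residual_coeff_def)
    then have neg: "finite_norm B (residual_coeff lam q (\<lambda>u. - exact u) a)"
      "hd_coeff B lam q (\<lambda>u. - exact u) a = hd_coeff B lam q exact a"
      using exact_residual(1)[OF a(1)] by (simp_all add: finite_norm_def hd_coeff_def formal_norm_def)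
    have "finite_norm B (residual_coeff lam q ?z a)"
      by (intro finite_residual_add exact_residual noise_residual a e)
    from hd_coeff_triangle[OF this neg(1)] show ?thesis
      by (simp add: neg(2))
  qed
  also have "hd_coeff B lam q exact a \<le> source_norm * a powr \<mu>"
    by (rule exact_residual[OF a(1)])
  also have "hd_coeff B lam q ?z a = psi_HD T B q (noisy_data T y e) a"
    by (simp add: psi_HD_eq[OF a(1) e])
  finally have data_bound: "formal_norm B ?data
      \<le> 2 * sqrt (C + 1) * (psi_HD T B q (noisy_data T y e) a + source_norm * a powr \<mu>)"
    using C by (simp add: mult_left_mono)
  have approx_hyp: "nn_powr (lam u) 0 * \<bar>- (?x \<bullet> sv u)\<bar> \<le> nn_powr (lam u) \<mu> * \<bar>\<omega> \<bullet> sv u\<bar>"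
    if "u \<in> B" for u
    using solution_coeff_bound[OF that] by (simp add: nn_powr_def)
  note approx = lam_nonneg a(1) \<mu> finite_norm_sv[of \<omega>] approx_hyp
  have approx_bound: "formal_norm B ?approx \<le> a powr \<mu> * source_norm"
    unfolding source_norm_def by (rule formal_norm_residual_bound[OF approx])
  \<comment> \<open>At a zero eigenvalue \<open>sv u\<close> and the projected noise both vanish.
    Elsewhere projecting the noise changes nothing.\<close>
  have coeff: "(tikhonov T B (noisy_data T y e) a - ?x) \<bullet> sv u = ?data u + ?approx u"
    if u: "u \<in> B" for u
  proof (cases "lam u = 0")
    case True
    then have "sv u = 0" by (simp add: sv_def)
    then show ?thesis by (simp add: residual_coeff_def True)
  next
    case False
    have pos: "0 < lam u" using False lam_nonneg[OF u] by simp
    have "(tikhonov T B (noisy_data T y e) a - ?x) \<bullet> sv u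
        = sqrt (lam u) / (lam u + a) * (sqrt (lam u) * (?x \<bullet> sv u) + e u) - ?x \<bullet> sv u"
      unfolding noisy_data_eq inner_diff_left tikhonov_sv[OF p a(1) finite_noisy[OF e] u]
      by (simp add: exact_eq u)
    also have "\<dots> = ?data u + (lam u / (lam u + a) - 1) * (?x \<bullet> sv u)"
      using pos False by (simp add: formal_proj_basis[OF u] distrib_left left_diff_distrib)
    also have "lam u / (lam u + a) - 1 = - (a / (lam u + a))"
      using pos a by (simp add: field_simps)
    finally show ?thesis
      by (simp add: residual_coeff_def nn_powr_def)
  qed
  have "norm (tikhonov T B (noisy_data T y e) a - ?x)
      = formal_norm B (\<lambda>u. (tikhonov T B (noisy_data T y e) a - ?x) \<bullet> sv u)"
  \<comment> \<open>Both the Tikhonov solution and the best approximate solution are orthogonal to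
    the kernel, so the coefficients along \<open>sv\<close> capture the whole error.\<close>
  proof (rule formal_norm_sv[symmetric])
    fix n assume n: "T n = 0"
    have "tikhonov T B (noisy_data T y e) a \<bullet> n = 0"
      unfolding noisy_data_eq
      by (rule sv_series_orth_kernel[OF tikhonov_series[OF p a(1) finite_noisy[OF e]] n])
    then show "(tikhonov T B (noisy_data T y e) a - ?x) \<bullet> n = 0"
      using mp_inverse_orth_kernel[OF y n] by (simp add: inner_diff_left)
  qed
  also have "\<dots> = formal_norm B (\<lambda>u. ?data u + ?approx u)"
    unfolding formal_norm_def by (simp add: coeff cong: infsum_cong)
  also have "\<dots> \<le> formal_norm B ?data + formal_norm B ?approx"
    by (rule formal_norm_triangle[OF finite_data_error[OF hyps] finite_residual_bound[OF approx]])
  finally show ?thesis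
    using data_bound approx_bound by (simp add: algebra_simps)
qed

lemma convergence_rate:
  assumes L: "0 < onorm T" and u: "u \<in> B" "nn_powr (lam u) q * \<bar>exact u\<bar> \<noteq> 0"
  shows "\<exists>\<eta>0>0. \<forall>C>0. \<exists>K. \<forall>e \<eta> \<alpha>.
    finite_norm B (formal_powr (TTstar T) p e) \<and>
    \<eta> = formal_norm B (formal_powr (TTstar T) p e) \<and>
    0 < \<eta> \<and> \<eta> < \<eta>0 \<and>
    formal_proj T e \<in> noise_class T B (2 * q) C \<and>
    is_arg_min (psi_HD T B q (noisy_data T y e)) (\<lambda>a. 0 < a \<and> a < (onorm T)\<^sup>2) \<alpha> \<longrightarrow>
      norm (tikhonov T B (noisy_data T y e) \<alpha> - mp_inverse T y)
        \<le> K * \<eta> powr ((2 * \<mu> / (2 * \<mu> + 2 * p + 1)) * (2 * \<mu> / (1 - 2 * q)))"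
proof -
  define L where "L = (onorm T)\<^sup>2"
  define s where "s = 2 * \<mu> + 2 * p + 1"
  define c0 where "c0 = nn_powr (lam u) q * \<bar>exact u\<bar>"
  define N where "N = nn_powr L (q - p)"
  \<comment> \<open>The first bound gives \<eta> \<le> \<open>1\<close> for the comparison of
    powers, the second keeps the comparison parameter \<open>t\<close> below \<open>L\<close>, and
    the third makes the noise at \<open>u\<close> at most half of the exact coefficient.\<close>
  define \<eta>0 where "\<eta>0 = min 1 (min (L powr (s / 2)) (c0 / (2 * N)))"
  have "0 < L" using L by (simp add: L_def)
  have "0 < N" using \<open>0 < L\<close> by (simp add: N_def nn_powr_pos)
  have "0 < c0" using u(2) unfolding c0_def by (simp add: less_le)
  have "0 < s" using p \<mu> by (simp add: s_def)
  have "0 \<le> source_norm" by (simp add: source_norm_def)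
  \<comment> \<open>The constant is the one of \<open>rate_from_discrepancy_bounds\<close> with
    \<open>M = source_norm + 1\<close> and \<open>c = c0 / (4 * L)\<close>. It involves
    \<open>C\<close> and the fixed data, but neither \<open>e\<close>, \<eta> nor \<alpha>.\<close>
  have rate: "norm (tikhonov T B (noisy_data T y e) \<alpha> - mp_inverse T y)
      \<le> (2 * sqrt (C + 1) * (source_norm + 1)
          + (2 * sqrt (C + 1) + 1) * source_norm * ((source_norm + 1) / (c0 / (4 * L))) powr (2 * \<mu> / (1 - 2 * q)))
        * \<eta> powr ((2 * \<mu> / s) * (2 * \<mu> / (1 - 2 * q)))"
    if C: "0 < C" and e: "finite_norm B (\<lambda>u. nn_powr (lam u) p * e u)"
      and \<eta>: "\<eta> = formal_norm B (\<lambda>u. nn_powr (lam u) p * e u)" "0 < \<eta>" "\<eta> < \<eta>0"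
      and noise: "formal_proj T e \<in> noise_class T B (2 * q) C"
      and min: "is_arg_min (psi_HD T B q (noisy_data T y e)) (\<lambda>a. 0 < a \<and> a < L) \<alpha>"
    for C e \<eta> \<alpha>
  proof -
    let ?psi = "psi_HD T B q (noisy_data T y e)"
    have \<alpha>: "0 < \<alpha>" "\<alpha> < L" and le: "\<And>t. 0 < t \<Longrightarrow> t < L \<Longrightarrow> ?psi \<alpha> \<le> ?psi t"
      using min unfolding is_arg_min_def not_less[symmetric] by blast+
    \<comment> \<open>This choice balances the two terms of \<open>psi_HD_upper_bound\<close>:
      \<open>t powr\<close>\<mu> equals \<open>t powr (- p - 1/2) *\<close>\<eta>.\<close>
    define t where "t = \<eta> powr (2 / s)"
    have "t < (L powr (s / 2)) powr (2 / s)"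
      unfolding t_def using \<eta> \<open>0 < s\<close> by (intro powr_less_mono2) (auto simp: \<eta>0_def)
    also have "\<dots> = L"
      using \<open>0 < s\<close> \<open>0 < L\<close> by (simp add: powr_powr)
    finally have "0 < t" "t < L"
      using \<eta> by (auto simp: t_def)
    have t1: "t powr \<mu> = \<eta> powr (2 * \<mu> / s)"
      by (simp add: t_def powr_powr mult.commute)
    have "2 / s * (- p - 1/2) + 1 = 2 * \<mu> / s"
      using \<open>0 < s\<close> by (simp add: s_def field_simps)
    then have t2: "t powr (- p - 1/2) * \<eta> = \<eta> powr (2 * \<mu> / s)"
      using \<eta> powr_add[of \<eta> "2 / s * (- p - 1/2)" 1] by (simp add: t_def powr_powr)
    have upper: "?psi \<alpha> \<le> (source_norm + 1) * \<eta> powr (2 * \<mu> / s)"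
      using le[OF \<open>0 < t\<close> \<open>t < L\<close>] psi_HD_upper_bound[OF \<open>0 < t\<close> e]
      unfolding \<eta>(1)[symmetric] t1 t2 by (simp add: distrib_right)
    have "\<eta> * (2 * N) \<le> c0"
      using \<eta> \<open>0 < N\<close> by (simp add: \<eta>0_def field_simps)
    then have "2 * (nn_powr ((onorm T)\<^sup>2) (q - p) * formal_norm B (\<lambda>u. nn_powr (lam u) p * e u))
        \<le> nn_powr (lam u) q * \<bar>exact u\<bar>"
      unfolding \<eta>(1)[symmetric] by (simp add: N_def L_def c0_def mult_ac)
    from psi_HD_lower_bound[OF \<alpha>[unfolded L_def] e u(1) this]
    have lower: "c0 / (4 * L) * \<alpha> powr (1/2 - q) \<le> ?psi \<alpha>"
      by (simp add: c0_def L_def)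
    show ?thesis
      by (rule rate_from_discrepancy_bounds[OF \<alpha>(1) _ _ _ _ \<eta>(2) _ _ \<mu>(1) q lower upper
            error_bound[OF \<alpha>[unfolded L_def] e C noise]])
        (use \<open>0 < c0\<close> \<open>0 < L\<close> \<open>0 \<le> source_norm\<close> \<open>0 < s\<close> C \<eta>(3) \<mu>(1) in \<open>auto simp: \<eta>0_def\<close>)
  qed
  have "0 < \<eta>0"
    using \<open>0 < L\<close> \<open>0 < c0\<close> \<open>0 < N\<close> by (simp add: \<eta>0_def)
  then show ?thesis
    using rate unfolding formal_powr_eq L_def s_def by blast
qed

end

text \<open>The order of the quantifiers makes the O-statement precise: the smallness threshold is
  uniform in the noise class constant \<open>C\<close>, while \<open>K\<close> may depend on
  \<open>C\<close> but not on the individual noise.\<close>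

theorem theorem3:
  fixes T :: "'a::{real_inner,banach} \<Rightarrow> 'b::{real_inner,banach}"
    and B :: "'b set" and D :: "'a set"
    and y :: 'b and \<omega> :: 'a and p q \<mu> :: real
  assumes "compact_operator T" and "infinite_dimensional (range T)"
    and "eigenbasis (TTstar T) B" and "eigenbasis (TstarT T) D"
    and "y \<in> mp_domain T"
    and "0 \<le> p" and "p \<le> 1/2"
    and "p \<le> q" and "q \<le> p + 1" and "q \<le> 1/2 - \<mu>"
    and "0 \<le> \<mu>" and "\<mu> \<le> 1"
    and "op_powr (TTstar T) B q (orth_proj (closure (range T)) y) \<noteq> 0"
    and "mp_inverse T y = op_powr (TstarT T) D \<mu> \<omega>"
  shows "\<exists>\<eta>0>0. \<forall>C>0. \<exists>K. \<forall>e \<eta> \<alpha>.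
    finite_norm B (formal_powr (TTstar T) p e) \<and>
    \<eta> = formal_norm B (formal_powr (TTstar T) p e) \<and>
    0 < \<eta> \<and> \<eta> < \<eta>0 \<and>
    formal_proj T e \<in> noise_class T B (2 * q) C \<and>
    is_arg_min (psi_HD T B q (noisy_data T y e)) (\<lambda>a. 0 < a \<and> a < (onorm T)\<^sup>2) \<alpha> \<longrightarrow>
      norm (tikhonov T B (noisy_data T y e) \<alpha> - mp_inverse T y)
        \<le> K * \<eta> powr ((2 * \<mu> / (2 * \<mu> + 2 * p + 1)) * (2 * \<mu> / (1 - 2 * q)))"
proof -
  interpret tikhonov_problem T B D y \<omega> p q \<mu>
    using assms compact_operator_bounded_linear
    by (intro tikhonov_problem.intro hilbert_operator.intro tikhonov_problem_axioms.intro) auto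
  \<comment> \<open>A nonzero \<open>op_powr\<close> must have a nonzero term, which supplies the
    coordinate for the lower bound.\<close>
  obtain u where u: "u \<in> B" "nn_powr (lam u) q * exact u \<noteq> 0"
  proof (rule ccontr)
    assume "\<not> thesis"
    then have "(nn_powr (lam u) q * exact u) *\<^sub>R u = 0" if "u \<in> B" for u
      using \<open>u \<in> B\<close> \<open>\<And>u. u \<in> B \<Longrightarrow> nn_powr (lam u) q * exact u \<noteq> 0 \<Longrightarrow> thesis\<close> by auto
    then have "op_powr (TTstar T) B q (orth_proj (closure (range T)) y) = 0"
      unfolding op_powr_def exact_def by (rule infsum_0)
    with assms(13) show False ..
  qed
  \<comment> \<open>The coefficient \<open>exact u\<close> carries the factor
    \<open>sqrt (lam u)\<close>, which would vanish together with the operator norm.\<close>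
  have "onorm T \<noteq> 0"
  proof
    assume "onorm T = 0"
    then have "lam u = 0"
      using lam_nonneg[OF u(1)] lam_le[OF u(1)] by simp
    then show False
      using u by (simp add: exact_eq)
  qed
  then have "0 < onorm T"
    using onorm_pos_le[OF bounded] by simp
  moreover have "nn_powr (lam u) q * \<bar>exact u\<bar> \<noteq> 0"
    using u(2) by simp
  ultimately show ?thesis
    using u(1) by (intro convergence_rate)
qed

end
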